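(* Let $t \in \Bbbk$ and let $R = \Bbbk[z][x,y;\sigma,a]$ be the classical generalized Weyl algebra with $\sigma(z)=z-1$ and $a = z(z-t)$. Let $g$ be a filtered automorphism of $R$ of finite order $\ell$ with $2 \le \ell < \infty$. Then the action of $g$ is diagonalizable, and hence the fixed ring $R^{\langle g\rangle} = \{r \in R : g(r) = r\}$ is again (isomorphic to) a classical generalized Weyl algebra.
   Context: $\Bbbk$ is an algebraically closed field of characteristic zero; all algebras are $\Bbbk$-algebras. Generalized Weyl algebra (GWA): for a ring $D$, $\sigma\in\operatorname{Aut}(D)$ and $a$ in the center of $D$, $D[x,y;\sigma,a]$ is the ring obtained by adjoining to $D$ the variables $x,y$ subject to the relations $xy=\sigma(a)$, $yx=a$, $xd=\sigma(d)x$, $yd=\sigma^{-1}(d)y$ for all $d\in D$. It is a classical GWA if $D=\Bbbk[z]$ and $\sigma(z)=z-\alpha$ for some $\alpha\in\Bbbk^\times$. Standard filtration: for $n=\deg_z(a)$, it is the filtration on $R$ defined by $\deg x=\deg y=n$, $\deg z=2$ (here $n=2$). A filtered automorphism is a $\Bbbk$-algebra automorphism $\phi$ of $R$ with $\deg(\phi(r))=\deg(r)$ for all $r\in R$. Diagonalizable: the action of $g$ on $R$ is diagonalizable if there are generators $X,Y,Z$ of $R$ with respect to which $R$ has a presentation as a classical GWA $\Bbbk[Z][X,Y;\varsigma,a'(Z)]$ and each of $X,Y,Z$ is mapped by $g$ to a scalar multiple of itself. *)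

theory Defs
  imports
    "HOL-Library.Poly_Mapping"
    "HOL-Computational_Algebra.Polynomial"
    "HOL-Algebra.Algebraic_Closure_Type"
    "HOL-Algebra.Multiplicative_Group"
    "HOL-Algebra.Bij"
begin

section \<open>Free rings\<close>

text \<open>
  Words are wrapped in a datatype of their own so that they can be made an (additively written)
  monoid; the monoid ring \<open>'g free_monoid \<Rightarrow>\<^sub>0 int\<close> is then the free noncommutative ring
  on the set of letters \<open>'g\<close>.
\<close>

datatype 'g free_monoid = Free_Monoid (letters: "'g list")

instantiation free_monoid :: (type) monoid_add
begin

definition "0 = Free_Monoid []"

definition "u + v = Free_Monoid (letters u @ letters v)"

instance
  by standard (simp_all add: zero_free_monoid_def plus_free_monoid_def)

end

type_synonym 'g free_ring = "'g free_monoid \<Rightarrow>\<^sub>0 int"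

definition letter :: "'g \<Rightarrow> 'g free_ring" where
  "letter u = Poly_Mapping.single (Free_Monoid [u]) 1"

section \<open>Generalized Weyl algebras\<close>

text \<open>
  \<open>D[x, y; \<sigma>, a]\<close> is presented by one letter \<open>Coef d\<close> for each \<open>d\<close> in \<open>D\<close> and two letters
  for \<open>x\<close> and \<open>y\<close>. The first three families of relations make \<open>Coef\<close> a unital ring homomorphism
  (so that modulo these alone one obtains \<open>D\<close> with two free noncommuting variables adjoined);
  the others are the defining relations of the generalized Weyl algebra.
\<close>

datatype 'd gwa_letter = Coef 'd | LetterX | LetterY

type_synonym 'd gwa_elt = "'d gwa_letter free_ring set"

definition gwa_relations :: "('d::ring_1 \<Rightarrow> 'd) \<Rightarrow> 'd \<Rightarrow> 'd gwa_letter free_ring set" where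
  "gwa_relations \<sigma> a =
    (let c = (\<lambda>d. letter (Coef d)); x = letter LetterX; y = letter LetterY in
      {c (d + e) - (c d + c e) | d e. True} \<union>
      {c (d * e) - c d * c e | d e. True} \<union>
      {c 1 - 1} \<union>
      {x * y - c (\<sigma> a), y * x - c a} \<union>
      {x * c d - c (\<sigma> d) * x | d. True} \<union>
      {y * c d - c (inv_into UNIV \<sigma> d) * y | d. True})"

definition gwa_ideal :: "('d::ring_1 \<Rightarrow> 'd) \<Rightarrow> 'd \<Rightarrow> 'd gwa_letter free_ring set" where
  "gwa_ideal \<sigma> a = genideal ring_of_type_algebra (gwa_relations \<sigma> a)"

definition gwa :: "('d::ring_1 \<Rightarrow> 'd) \<Rightarrow> 'd \<Rightarrow> 'd gwa_elt ring" where
  "gwa \<sigma> a = ring_of_type_algebra Quot gwa_ideal \<sigma> a"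

definition gwa_class :: "('d::ring_1 \<Rightarrow> 'd) \<Rightarrow> 'd \<Rightarrow> 'd gwa_letter free_ring \<Rightarrow> 'd gwa_elt" where
  "gwa_class \<sigma> a r = gwa_ideal \<sigma> a +>\<^bsub>ring_of_type_algebra\<^esub> r"

section \<open>Algebras over a field\<close>

text \<open>
  A \<open>'k\<close>-algebra is given by the record \<open>('k, 'r) module\<close>, which carries both a ring structure
  and a scalar multiplication. The locale \<open>algebra\<close> of HOL-Algebra is not applicable, since it
  requires the algebra to be commutative.
\<close>

definition alg_iso :: "('k, 'r) module \<Rightarrow> ('k, 's) module \<Rightarrow> ('r \<Rightarrow> 's) set" where
  "alg_iso R S =
    {\<phi> \<in> ring_iso R S. \<forall>c. \<forall>r\<in>carrier R. \<phi> (c \<odot>\<^bsub>R\<^esub> r) = c \<odot>\<^bsub>S\<^esub> \<phi> r}"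

text \<open>
  Automorphisms are extensional functions, so that they are elements of the group
  \<open>BijGroup (carrier R)\<close>.
\<close>

definition alg_aut :: "('k, 'r) module \<Rightarrow> ('r \<Rightarrow> 'r) set" where
  "alg_aut R = alg_iso R R \<inter> extensional (carrier R)"

definition fixed_ring :: "('k, 'r) module \<Rightarrow> ('r \<Rightarrow> 'r) \<Rightarrow> ('k, 'r) module" where
  "fixed_ring R g = R\<lparr>carrier := {r \<in> carrier R. g r = r}\<rparr>"

section \<open>Classical generalized Weyl algebras\<close>

definition shift :: "'k::field \<Rightarrow> 'k poly \<Rightarrow> 'k poly" where
  "shift \<alpha> p = pcompose p [:- \<alpha>, 1:]"

definition cgwa_coef :: "'k::field \<Rightarrow> 'k poly \<Rightarrow> 'k poly \<Rightarrow> 'k poly gwa_elt" where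
  "cgwa_coef \<alpha> a p = gwa_class (shift \<alpha>) a (letter (Coef p))"

definition cgwa_x :: "'k::field \<Rightarrow> 'k poly \<Rightarrow> 'k poly gwa_elt" where
  "cgwa_x \<alpha> a = gwa_class (shift \<alpha>) a (letter LetterX)"

definition cgwa_y :: "'k::field \<Rightarrow> 'k poly \<Rightarrow> 'k poly gwa_elt" where
  "cgwa_y \<alpha> a = gwa_class (shift \<alpha>) a (letter LetterY)"

definition cgwa_z :: "'k::field \<Rightarrow> 'k poly \<Rightarrow> 'k poly gwa_elt" where
  "cgwa_z \<alpha> a = cgwa_coef \<alpha> a [:0, 1:]"

text \<open>
  This is a classical generalized Weyl algebra only for \<open>\<alpha> \<noteq> 0\<close>, which is required wherever
  the algebra is used.
\<close>

definition cgwa :: "'k::field \<Rightarrow> 'k poly \<Rightarrow> ('k, 'k poly gwa_elt) module" where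
  "cgwa \<alpha> a = ring.extend (gwa (shift \<alpha>) a)
     (module.fields (\<lambda>c r. cgwa_coef \<alpha> a [:c:] \<otimes>\<^bsub>gwa (shift \<alpha>) a\<^esub> r))"

definition is_classical_gwa :: "('k::field, 'r) module \<Rightarrow> bool" where
  "is_classical_gwa R \<longleftrightarrow> (\<exists>\<alpha> a \<phi>. \<alpha> \<noteq> 0 \<and> \<phi> \<in> alg_iso (cgwa \<alpha> a) R)"

text \<open>\<open>R\<close> is presented as the classical generalized Weyl algebra \<open>\<bbbk>[Z][X, Y; \<varsigma>, a(Z)]\<close>
  with \<open>\<varsigma>(Z) = Z - \<alpha>\<close>, where \<open>x', y', z'\<close> stand for \<open>X, Y, Z\<close>.\<close>

definition classical_gwa_presentation ::
  "('k::field, 'r) module \<Rightarrow> 'k \<Rightarrow> 'k poly \<Rightarrow> 'r \<Rightarrow> 'r \<Rightarrow> 'r \<Rightarrow> bool" where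
  "classical_gwa_presentation R \<alpha> a x' y' z' \<longleftrightarrow> \<alpha> \<noteq> 0 \<and>
    (\<exists>\<phi> \<in> alg_iso (cgwa \<alpha> a) R.
      \<phi> (cgwa_x \<alpha> a) = x' \<and> \<phi> (cgwa_y \<alpha> a) = y' \<and> \<phi> (cgwa_z \<alpha> a) = z')"

definition diagonalizable_action :: "('k::field, 'r) module \<Rightarrow> ('r \<Rightarrow> 'r) \<Rightarrow> bool" where
  "diagonalizable_action R g \<longleftrightarrow>
    (\<exists>\<alpha> a x' y' z'. classical_gwa_presentation R \<alpha> a x' y' z' \<and>
      (\<exists>c. g x' = c \<odot>\<^bsub>R\<^esub> x') \<and> (\<exists>c. g y' = c \<odot>\<^bsub>R\<^esub> y') \<and> (\<exists>c. g z' = c \<odot>\<^bsub>R\<^esub> z'))"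

section \<open>The standard filtration\<close>

text \<open>
  The smallest exhaustive multiplicative filtration with \<open>x\<close> and \<open>y\<close> in degree \<open>deg a\<close> and \<open>z\<close>
  in degree 2: its \<open>m\<close>-th piece is spanned by the words in \<open>x, y, z\<close> of weighted degree at
  most \<open>m\<close>.
\<close>

inductive std_filtration ::
  "'k::field \<Rightarrow> 'k poly \<Rightarrow> nat \<Rightarrow> 'k poly gwa_elt \<Rightarrow> bool" for \<alpha> :: 'k and a :: "'k poly" where
  scalar: "std_filtration \<alpha> a m (c \<odot>\<^bsub>cgwa \<alpha> a\<^esub> \<one>\<^bsub>cgwa \<alpha> a\<^esub>)"
| x: "Polynomial.degree a \<le> m \<Longrightarrow> std_filtration \<alpha> a m (cgwa_x \<alpha> a)"
| y: "Polynomial.degree a \<le> m \<Longrightarrow> std_filtration \<alpha> a m (cgwa_y \<alpha> a)"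
| z: "2 \<le> m \<Longrightarrow> std_filtration \<alpha> a m (cgwa_z \<alpha> a)"
| add: "std_filtration \<alpha> a m r \<Longrightarrow> std_filtration \<alpha> a m s \<Longrightarrow>
    std_filtration \<alpha> a m (r \<oplus>\<^bsub>cgwa \<alpha> a\<^esub> s)"
| mult: "std_filtration \<alpha> a i r \<Longrightarrow> std_filtration \<alpha> a j s \<Longrightarrow> i + j \<le> m \<Longrightarrow>
    std_filtration \<alpha> a m (r \<otimes>\<^bsub>cgwa \<alpha> a\<^esub> s)"

text \<open>
  The zero element gets degree 0 instead of \<open>-\<infinity>\<close>; this does not affect the notion of a filtered
  automorphism, because automorphisms preserve being zero.
\<close>

definition std_degree :: "'k::field \<Rightarrow> 'k poly \<Rightarrow> 'k poly gwa_elt \<Rightarrow> nat" where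
  "std_degree \<alpha> a r = (LEAST m. std_filtration \<alpha> a m r)"

definition filtered_aut ::
  "'k::field \<Rightarrow> 'k poly \<Rightarrow> ('k poly gwa_elt \<Rightarrow> 'k poly gwa_elt) set" where
  "filtered_aut \<alpha> a = {\<phi> \<in> alg_aut (cgwa \<alpha> a).
     \<forall>r \<in> carrier (cgwa \<alpha> a). std_degree \<alpha> a (\<phi> r) = std_degree \<alpha> a r}"

end

theory Submission
  imports Defs
begin

text \<open>
  Write \<open>h = z - (1 + t) / 2\<close>. The elements of degree at most 2 form the space
  \<open>V = \<bbbk> + L\<close>, where \<open>L\<close> is spanned by \<open>x, y, h\<close>, and the commutators
  \<open>[h, x] = x\<close>, \<open>[h, y] = - y\<close>, \<open>[x, y] = - 2 h\<close> make \<open>L = [V, V]\<close> a copy of \<open>sl\<^sub>2\<close>. A filtered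
  automorphism \<open>g\<close> preserves \<open>V\<close>, hence \<open>L\<close>, and acts on \<open>L\<close> as an automorphism of Lie algebras of
  finite order.

  Such an automorphism fixes a semisimple element. Since \<open>g\<close> has finite order it has an eigenvector
  \<open>u\<close> in \<open>L\<close>, and in a suitable standard basis \<open>x, y, h\<close> of \<open>L\<close> this \<open>u\<close> is a multiple of \<open>x\<close> (if it
  is nilpotent) or of \<open>h\<close> (if it is semisimple). If \<open>u\<close> is a multiple of \<open>x\<close>, then \<open>g h - h\<close> commutes
  with \<open>x\<close> and is a multiple of \<open>x\<close>; finite order in characteristic zero allows \<open>h\<close> to be corrected by
  a multiple of \<open>x\<close> to a fixed element (\<open>fixed_h_if_eigen_x\<close>). If \<open>u\<close> is a multiple of \<open>h\<close>, its eigenvalue is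
  1 or -1, and in the second case \<open>g\<close> exchanges the lines of \<open>x\<close> and \<open>y\<close> and fixes \<open>x + g x\<close>
  (\<open>fixed_h_if_eigen_h\<close>). As soon as \<open>h\<close> is fixed, \<open>g\<close> preserves the eigenlines of \<open>ad h\<close>, so that
  \<open>g x = \<nu> x\<close> and \<open>g y = \<nu>\<^sup>-\<^sup>1 y\<close> (\<open>diagonalizing_frame_exists\<close>). All changes of basis used
  here are products of \<open>exp (ad x)\<close>-like shears and of the exchange of \<open>x\<close> and \<open>y\<close>; they leave the
  Casimir element \<open>y x - h\<^sup>2 - h\<close> equal to the same scalar \<open>c\<close>. Therefore the new \<open>x, y, h\<close>
  satisfy the relations of the classical generalized Weyl algebra with \<open>a(h) = h\<^sup>2 + h + c\<close>, and \<open>g\<close> is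
  diagonal in this presentation.

  Every element is a unique sum of terms \<open>p\<^sub>k(h) x\<^sup>k\<close>, where \<open>x\<^sup>-\<^sup>k\<close> stands for \<open>y\<^sup>k\<close>, and \<open>g\<close>
  multiplies the \<open>k\<close>-th term by \<open>\<nu>\<^sup>k\<close>. Hence, if \<open>m\<close> is the multiplicative order of \<open>\<nu>\<close>, the fixed ring is
  generated by \<open>h, x\<^sup>m, y\<^sup>m\<close> (\<open>fixed_subalgebra_generated\<close>), which satisfy the relations of a
  classical generalized Weyl algebra with shift \<open>m\<close> (\<open>gwa_triple_power\<close>).

  To make this precise, all the algebras are embedded in one ring of linear operators. Elements
  \<open>x, y, z\<close> of a \<open>\<bbbk>\<close>-algebra that satisfy the relations induce a homomorphism from the presented
  algebra; for a nonzero shift and \<open>a \<noteq> 0\<close> it is injective as soon as \<open>z\<close> is transcendental, because the terms of a normal form are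
  separated by their weights under the commutator with \<open>z\<close> (\<open>free_lift_eq_iff\<close>,
  \<open>normal_form_components_eq_0\<close>). Isomorphisms between presented algebras and subalgebras then
  reduce to equalities of subalgebras of the ring of operators (\<open>cgwa_iso_of_generated\<close>).
\<close>

section \<open>Homomorphisms from free rings\<close>

definition free_lift :: "('g \<Rightarrow> 's::ring_1) \<Rightarrow> 'g free_ring \<Rightarrow> 's" where
  "free_lift \<theta> r =
    (\<Sum>w\<in>Poly_Mapping.keys r. of_int (Poly_Mapping.lookup r w) * prod_list (map \<theta> (letters w)))"

lemma free_lift_eq_sum:
  assumes "finite W" "Poly_Mapping.keys r \<subseteq> W"
  shows "free_lift \<theta> r =
    (\<Sum>w\<in>W. of_int (Poly_Mapping.lookup r w) * prod_list (map \<theta> (letters w)))"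
  unfolding free_lift_def
  by (rule sum.mono_neutral_left) (use assms in \<open>auto simp: in_keys_iff\<close>)

lemma free_lift_add: "free_lift \<theta> (r + s) = free_lift \<theta> r + free_lift \<theta> s"
proof -
  let ?W = "Poly_Mapping.keys r \<union> Poly_Mapping.keys s"
  have "Poly_Mapping.keys (r + s) \<subseteq> ?W" by (rule Poly_Mapping.keys_add)
  then show ?thesis
    by (simp add: free_lift_eq_sum[of ?W] lookup_add distrib_right sum.distrib)
qed

lemma free_lift_0: "free_lift \<theta> 0 = 0"
  by (simp add: free_lift_def)

lemma free_lift_uminus: "free_lift \<theta> (- r) = - free_lift \<theta> r"
  using free_lift_add[of \<theta> r "- r"] by (simp add: free_lift_0 eq_neg_iff_add_eq_0 add.commute)

lemma free_lift_diff: "free_lift \<theta> (r - s) = free_lift \<theta> r - free_lift \<theta> s"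
  using free_lift_add[of \<theta> r "- s"] by (simp add: free_lift_uminus)

lemma free_lift_single:
  "free_lift \<theta> (Poly_Mapping.single w c) = of_int c * prod_list (map \<theta> (letters w))"
  by (subst free_lift_eq_sum[of "{w}"]) auto

lemma free_lift_1: "free_lift \<theta> 1 = 1"
  by (simp flip: single_one add: free_lift_single zero_free_monoid_def)

lemma free_lift_letter: "free_lift \<theta> (letter u) = \<theta> u"
  by (simp add: letter_def free_lift_single)

text \<open>
  Both sides are additive in each factor, which reduces the claim to words.
\<close>

lemma free_lift_mult: "free_lift \<theta> (r * s) = free_lift \<theta> r * free_lift \<theta> s"
proof -
  have words: "free_lift \<theta> (frag_of v * frag_of w) = free_lift \<theta> (frag_of v) * free_lift \<theta> (frag_of w)"
    for v w :: "'b free_monoid"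
    by (simp add: mult_single free_lift_single plus_free_monoid_def)
  have word: "free_lift \<theta> (frag_of v * s) = free_lift \<theta> (frag_of v) * free_lift \<theta> s" for v
    using subset_UNIV[of "Poly_Mapping.keys s"] by (induction s rule: frag_induction)
      (simp_all add: words free_lift_0 free_lift_diff right_diff_distrib)
  show ?thesis
    using subset_UNIV[of "Poly_Mapping.keys r"] by (induction r rule: frag_induction)
      (simp_all add: word free_lift_0 free_lift_diff left_diff_distrib)
qed

text \<open>
  Subtraction takes the place of addition, negation and integer coefficients.
\<close>

lemma free_ring_induct [case_names one letter diff mult]:
  fixes r :: "'g free_ring"
  assumes one: "P 1" and letter: "\<And>u. P (letter u)"
    and diff: "\<And>r s. P r \<Longrightarrow> P s \<Longrightarrow> P (r - s)" and mult: "\<And>r s. P r \<Longrightarrow> P s \<Longrightarrow> P (r * s)"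
  shows "P r"
proof -
  have "P (frag_of (Free_Monoid us))" for us :: "'g list"
  proof (induction us)
    case Nil
    then show ?case
      using one by (simp flip: zero_free_monoid_def)
  next
    case (Cons u us)
    have "frag_of (Free_Monoid (u # us)) = letter u * frag_of (Free_Monoid us)"
      by (simp add: letter_def mult_single plus_free_monoid_def)
    with Cons show ?case by (simp add: letter mult)
  qed
  then have word: "P (frag_of w)" for w by (cases w) simp
  show ?thesis
    using subset_UNIV[of "Poly_Mapping.keys r"]
    by (induction r rule: frag_induction) (use word diff diff[OF one one] in simp_all)
qed

section \<open>The quotient that defines a generalized Weyl algebra\<close>

lemma free_ring_ops [simp]:
  "carrier ring_of_type_algebra = UNIV" "x \<otimes>\<^bsub>ring_of_type_algebra\<^esub> y = x * y"
  "x \<oplus>\<^bsub>ring_of_type_algebra\<^esub> y = x + y" "\<one>\<^bsub>ring_of_type_algebra\<^esub> = 1" "\<zero>\<^bsub>ring_of_type_algebra\<^esub> = 0"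
  by (simp_all add: ring_of_type_algebra_def)

lemma ring_ring_of_type_algebra: "ring (ring_of_type_algebra :: 'r::ring_1 ring)"
proof -
  have "\<exists>y. y + x = 0" for x :: 'r
    by (rule exI[of _ "- x"]) simp
  then show ?thesis
    by unfold_locales (auto simp: algebra_simps Units_def)
qed

lemma gwa_ideal_ideal: "ideal (gwa_ideal \<sigma> a) ring_of_type_algebra"
  unfolding gwa_ideal_def
  by (rule ring.genideal_ideal[OF ring_ring_of_type_algebra]) (simp add: ring_of_type_algebra_def)

lemma gwa_relations_in_ideal: "gwa_relations \<sigma> a \<subseteq> gwa_ideal \<sigma> a"
  unfolding gwa_ideal_def
  by (rule ring.genideal_self[OF ring_ring_of_type_algebra]) (simp add: ring_of_type_algebra_def)

lemma ideal_ring_of_type_algebra: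
  assumes "ideal I (ring_of_type_algebra :: 'r::ring_1 ring)"
  shows "0 \<in> I" "r \<in> I \<Longrightarrow> s \<in> I \<Longrightarrow> r + s \<in> I" "r \<in> I \<Longrightarrow> u * r \<in> I" "r \<in> I \<Longrightarrow> r * u \<in> I"
    "r \<in> I \<Longrightarrow> - r \<in> I"
proof -
  interpret ideal I "ring_of_type_algebra :: 'r ring" by fact
  show "0 \<in> I" using additive_subgroup.zero_closed[OF is_additive_subgroup] by simp
  show "r \<in> I \<Longrightarrow> s \<in> I \<Longrightarrow> r + s \<in> I" using additive_subgroup.a_closed[OF is_additive_subgroup] by simp
  show "r \<in> I \<Longrightarrow> u * r \<in> I" for u using I_l_closed[of r u] by simp
  show "r \<in> I \<Longrightarrow> r * u \<in> I" using I_r_closed[of r u] by simp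
  show "r \<in> I \<Longrightarrow> - r \<in> I" using I_l_closed[of r "-1"] by simp
qed

lemmas gwa_ideal_closed = ideal_ring_of_type_algebra[OF gwa_ideal_ideal]

lemma carrier_gwa: "carrier (gwa \<sigma> a) = range (gwa_class \<sigma> a)"
  by (auto simp: gwa_def FactRing_def A_RCOSETS_def RCOSETS_def gwa_class_def a_r_coset_def)

lemma gwa_class_hom:
  "gwa_class \<sigma> a r \<otimes>\<^bsub>gwa \<sigma> a\<^esub> gwa_class \<sigma> a s = gwa_class \<sigma> a (r * s)"
  "gwa_class \<sigma> a r \<oplus>\<^bsub>gwa \<sigma> a\<^esub> gwa_class \<sigma> a s = gwa_class \<sigma> a (r + s)"
  "\<one>\<^bsub>gwa \<sigma> a\<^esub> = gwa_class \<sigma> a 1"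
proof -
  interpret ideal "gwa_ideal \<sigma> a" ring_of_type_algebra by (rule gwa_ideal_ideal)
  show "gwa_class \<sigma> a r \<otimes>\<^bsub>gwa \<sigma> a\<^esub> gwa_class \<sigma> a s = gwa_class \<sigma> a (r * s)"
    "gwa_class \<sigma> a r \<oplus>\<^bsub>gwa \<sigma> a\<^esub> gwa_class \<sigma> a s = gwa_class \<sigma> a (r + s)"
    "\<one>\<^bsub>gwa \<sigma> a\<^esub> = gwa_class \<sigma> a 1"
    using ring_hom_mult[OF rcos_ring_hom, of r s] ring_hom_add[OF rcos_ring_hom, of r s]
      ring_hom_one[OF rcos_ring_hom]
    by (simp_all add: gwa_def gwa_class_def)
qed

lemma gwa_class_eq_iff: "gwa_class \<sigma> a r = gwa_class \<sigma> a s \<longleftrightarrow> r - s \<in> gwa_ideal \<sigma> a"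
proof -
  have coset: "gwa_class \<sigma> a u = {i + u | i. i \<in> gwa_ideal \<sigma> a}" for u
    by (auto simp: gwa_class_def a_r_coset_def r_coset_def)
  show ?thesis
  proof
    assume "gwa_class \<sigma> a r = gwa_class \<sigma> a s"
    moreover have "r \<in> gwa_class \<sigma> a r"
      unfolding coset using gwa_ideal_closed(1) by force
    ultimately show "r - s \<in> gwa_ideal \<sigma> a" unfolding coset by force
  next
    assume rs: "r - s \<in> gwa_ideal \<sigma> a"
    have "i + r = (i + (r - s)) + s" "i + s = (i + - (r - s)) + r" for i by simp_all
    then show "gwa_class \<sigma> a r = gwa_class \<sigma> a s"
      unfolding coset using gwa_ideal_closed(2)[OF _ rs] gwa_ideal_closed(2)[OF _ gwa_ideal_closed(5)[OF rs]]
      by (auto; blast)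
  qed
qed

lemma gwa_class_cong:
  assumes "gwa_class \<sigma> a r = gwa_class \<sigma> a r'" "gwa_class \<sigma> a s = gwa_class \<sigma> a s'"
  shows "gwa_class \<sigma> a (r + s) = gwa_class \<sigma> a (r' + s')"
    and "gwa_class \<sigma> a (r * s) = gwa_class \<sigma> a (r' * s')"
  using assms by (metis gwa_class_hom(2)) (metis assms gwa_class_hom(1))

lemma gwa_class_sum_cong:
  assumes "\<And>k. k \<in> K \<Longrightarrow> gwa_class \<sigma> a (f k) = gwa_class \<sigma> a (h k)"
  shows "gwa_class \<sigma> a (sum f K) = gwa_class \<sigma> a (sum h K)"
  using assms
proof (induction K rule: infinite_finite_induct)
  case (insert k K)
  then have "gwa_class \<sigma> a (f k + sum f K) = gwa_class \<sigma> a (h k + sum h K)"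
    by (intro gwa_class_cong(1)) simp_all
  with insert show ?case by simp
qed simp_all

lemma gwa_class_relations:
  fixes \<sigma> :: "'d::ring_1 \<Rightarrow> 'd"
  shows "gwa_class \<sigma> a (letter (Coef (d + e))) = gwa_class \<sigma> a (letter (Coef d) + letter (Coef e))"
    and "gwa_class \<sigma> a (letter (Coef (d * e))) = gwa_class \<sigma> a (letter (Coef d) * letter (Coef e))"
    and "gwa_class \<sigma> a (letter (Coef 1)) = gwa_class \<sigma> a 1"
    and "gwa_class \<sigma> a (letter LetterX * letter LetterY) = gwa_class \<sigma> a (letter (Coef (\<sigma> a)))"
    and "gwa_class \<sigma> a (letter LetterY * letter LetterX) = gwa_class \<sigma> a (letter (Coef a))"
    and "gwa_class \<sigma> a (letter LetterX * letter (Coef d)) = gwa_class \<sigma> a (letter (Coef (\<sigma> d)) * letter LetterX)"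
    and "gwa_class \<sigma> a (letter LetterY * letter (Coef d)) =
      gwa_class \<sigma> a (letter (Coef (inv_into UNIV \<sigma> d)) * letter LetterY)"
  unfolding gwa_class_eq_iff
  by (rule subsetD[OF gwa_relations_in_ideal], simp add: gwa_relations_def Let_def, blast?)+

section \<open>Normal forms\<close>

text \<open>
  The rungs \<open>\<dots>, y\<^sup>2, y, 1, x, x\<^sup>2, \<dots>\<close>, indexed by their degree for the grading in which \<open>x\<close> has degree 1
  and \<open>y\<close> has degree -1: they form a basis of a generalized Weyl algebra as a left module over \<open>D\<close>.
\<close>

definition ladder :: "'r::monoid_mult \<Rightarrow> 'r \<Rightarrow> int \<Rightarrow> 'r" where
  "ladder x y k = (if k \<ge> 0 then x ^ nat k else y ^ nat (- k))"

lemma ladder_0 [simp]: "ladder x y 0 = 1"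
  by (simp add: ladder_def)

lemma ladder_raise: "k \<ge> 0 \<Longrightarrow> x * ladder x y k = ladder x y (k + 1)"
  by (simp add: ladder_def nat_add_distrib)

lemma ladder_lower: "k \<le> 0 \<Longrightarrow> y * ladder x y k = ladder x y (k - 1)"
proof -
  assume "k \<le> 0"
  then have "nat (1 - k) = Suc (nat (- k))" by simp
  with \<open>k \<le> 0\<close> show ?thesis by (simp add: ladder_def)
qed

lemma ladder_Suc: "k > 0 \<Longrightarrow> ladder x y k = x * ladder x y (k - 1)"
  using ladder_raise[of "k - 1" x y] by simp

lemma ladder_pred: "k < 0 \<Longrightarrow> ladder x y k = y * ladder x y (k + 1)"
  using ladder_lower[of "k + 1" y x] by simp

definition normal_form :: "(int \<Rightarrow> 'd) \<Rightarrow> int set \<Rightarrow> 'd gwa_letter free_ring" where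
  "normal_form p K = (\<Sum>k\<in>K. letter (Coef (p k)) * ladder (letter LetterX) (letter LetterY) k)"

context
  fixes \<sigma> :: "'d::ring_1 \<Rightarrow> 'd" and a :: 'd
begin

abbreviation coef :: "'d \<Rightarrow> 'd gwa_letter free_ring" where "coef d \<equiv> letter (Coef d)"
abbreviation xx :: "'d gwa_letter free_ring" where "xx \<equiv> letter LetterX"
abbreviation yy :: "'d gwa_letter free_ring" where "yy \<equiv> letter LetterY"
abbreviation rung :: "int \<Rightarrow> 'd gwa_letter free_ring" where "rung \<equiv> ladder xx yy"
abbreviation eqv (infix "\<approx>" 50) where "eqv r s \<equiv> gwa_class \<sigma> a r = gwa_class \<sigma> a s"

text \<open>
  The reducible elements turn out to be all elements of the free ring: they contain \<open>1\<close>, and they are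
  closed under multiplication by a letter from the left, because modulo the relations each letter moves
  a term with coefficient to a single term on an adjacent or the same rung.
\<close>

definition reducible :: "'d gwa_letter free_ring \<Rightarrow> bool" where
  "reducible r \<longleftrightarrow> (\<exists>p K. finite K \<and> r \<approx> normal_form p K)"

lemma reducibleI: "r \<approx> normal_form p K \<Longrightarrow> finite K \<Longrightarrow> reducible r"
  unfolding reducible_def by blast

lemma reducible_cong: "r \<approx> s \<Longrightarrow> reducible s \<Longrightarrow> reducible r"
  by (auto simp: reducible_def)

lemma coef_0: "coef 0 \<approx> 0"
proof -
  have "coef (0 + 0) - (coef 0 + coef 0) \<in> gwa_ideal \<sigma> a"
    using gwa_class_relations(1)[of \<sigma> a 0 0] unfolding gwa_class_eq_iff .
  from gwa_ideal_closed(5)[OF this] show ?thesis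
    by (simp add: gwa_class_eq_iff)
qed

lemma coef_uminus_1: "coef (- 1) \<approx> - 1"
proof -
  have "coef 1 + coef (- 1) \<approx> 0"
    using gwa_class_relations(1)[of \<sigma> a 1 "- 1"] coef_0 by simp
  then have "coef (- 1) \<approx> - coef 1"
    by (simp add: gwa_class_eq_iff add.commute)
  also have "- coef 1 \<approx> - 1"
    using gwa_class_cong(2)[of \<sigma> a "- 1" "- 1" "coef 1" 1] gwa_class_relations(3)[of \<sigma> a] by simp
  finally show ?thesis .
qed

text \<open>
  This allows two normal forms to be brought to the same index set before they are added.
\<close>

lemma normal_form_extend:
  assumes "finite L" "K \<subseteq> L"
  shows "normal_form p K \<approx> normal_form (\<lambda>k. if k \<in> K then p k else 0) L"
proof -
  have split: "normal_form (\<lambda>k. if k \<in> K then p k else 0) L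
      = normal_form p K + (\<Sum>k\<in>L - K. coef 0 * rung k)"
    unfolding normal_form_def using assms by (subst sum.subset_diff[of K L]) (auto simp: add.commute)
  have "(\<Sum>k\<in>L - K. coef 0 * rung k) \<approx> (\<Sum>k\<in>L - K. 0 * rung k)"
    by (intro gwa_class_sum_cong gwa_class_cong coef_0 refl)
  from gwa_class_cong(1)[OF refl this, of "normal_form p K"] show ?thesis
    by (simp add: split)
qed

lemma reducible_add:
  assumes "reducible r" "reducible s"
  shows "reducible (r + s)"
proof -
  obtain p K q L where K: "finite K" "r \<approx> normal_form p K" and L: "finite L" "s \<approx> normal_form q L"
    using assms by (auto simp: reducible_def)
  define p' where "p' = (\<lambda>k. if k \<in> K then p k else 0)"
  define q' where "q' = (\<lambda>k. if k \<in> L then q k else 0)"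
  have "r + s \<approx> normal_form p' (K \<union> L) + normal_form q' (K \<union> L)"
    using normal_form_extend[of "K \<union> L" K p] normal_form_extend[of "K \<union> L" L q] K L
    by (intro gwa_class_cong) (simp_all add: p'_def q'_def)
  also have "normal_form p' (K \<union> L) + normal_form q' (K \<union> L)
      = (\<Sum>k\<in>K \<union> L. (coef (p' k) + coef (q' k)) * rung k)"
    by (simp add: normal_form_def sum.distrib distrib_right)
  also have "\<dots> \<approx> normal_form (\<lambda>k. p' k + q' k) (K \<union> L)"
    unfolding normal_form_def
    by (intro gwa_class_sum_cong gwa_class_cong refl) (rule gwa_class_relations(1)[symmetric])
  finally show ?thesis by (rule reducibleI) (use K(1) L(1) in simp)
qed

lemma reducible_act:
  assumes "reducible r"
    and act: "\<And>d k. u * (coef d * rung k) \<approx> coef (f d k) * rung (k + j)"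
  shows "reducible (u * r)"
proof -
  obtain p K where K: "finite K" "r \<approx> normal_form p K"
    using assms(1) by (auto simp: reducible_def)
  have "u * r \<approx> u * normal_form p K"
    by (intro gwa_class_cong refl K)
  also have "u * normal_form p K = (\<Sum>k\<in>K. u * (coef (p k) * rung k))"
    by (simp add: normal_form_def sum_distrib_left)
  also have "\<dots> \<approx> (\<Sum>k\<in>K. coef (f (p k) k) * rung (k + j))"
    by (intro gwa_class_sum_cong act)
  also have "(\<Sum>k\<in>K. coef (f (p k) k) * rung (k + j))
      = normal_form (\<lambda>k. f (p (k - j)) (k - j)) ((\<lambda>k. k + j) ` K)"
    unfolding normal_form_def by (subst sum.reindex) auto
  finally show ?thesis by (rule reducibleI) (use K(1) in simp)
qed

lemma coef_act: "coef c * (coef d * rung k) \<approx> coef (c * d) * rung (k + 0)"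
  using gwa_class_cong(2)[OF gwa_class_relations(2)[of \<sigma> a c d] refl, of "rung k"]
  by (simp add: mult.assoc)

text \<open>
  On the rungs of negative degree, \<open>x\<close> meets a factor \<open>y\<close>, and \<open>x y = \<sigma> a\<close> is absorbed into the coefficient.
\<close>

lemma x_act:
  "xx * (coef d * rung k) \<approx> coef (if k \<ge> 0 then \<sigma> d else \<sigma> d * \<sigma> a) * rung (k + 1)"
proof -
  have comm: "xx * (coef d * rung k) \<approx> coef (\<sigma> d) * (xx * rung k)"
    using gwa_class_cong(2)[OF gwa_class_relations(6)[of \<sigma> a d] refl, of "rung k"]
    by (simp add: mult.assoc)
  show ?thesis
  proof (cases "k \<ge> 0")
    case True
    with comm show ?thesis by (simp add: ladder_raise)
  next
    case False
    have "coef (\<sigma> d) * (xx * rung k) = coef (\<sigma> d) * (xx * yy) * rung (k + 1)"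
      using False by (simp add: ladder_pred[of k] mult.assoc)
    also have "\<dots> \<approx> coef (\<sigma> d) * coef (\<sigma> a) * rung (k + 1)"
      by (intro gwa_class_cong gwa_class_relations refl)
    also have "\<dots> = gwa_class \<sigma> a (coef (\<sigma> d * \<sigma> a) * rung (k + 1))"
      by (intro gwa_class_cong gwa_class_relations(2)[symmetric] refl)
    finally show ?thesis using comm False by simp
  qed
qed

lemma y_act:
  "yy * (coef d * rung k)
    \<approx> coef (if k \<le> 0 then inv_into UNIV \<sigma> d else inv_into UNIV \<sigma> d * a) * rung (k + - 1)"
proof -
  have comm: "yy * (coef d * rung k) \<approx> coef (inv_into UNIV \<sigma> d) * (yy * rung k)"
    using gwa_class_cong(2)[OF gwa_class_relations(7)[of \<sigma> a d] refl, of "rung k"]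
    by (simp add: mult.assoc)
  show ?thesis
  proof (cases "k \<le> 0")
    case True
    with comm show ?thesis by (simp add: ladder_lower)
  next
    case False
    have "coef (inv_into UNIV \<sigma> d) * (yy * rung k)
        = coef (inv_into UNIV \<sigma> d) * (yy * xx) * rung (k + - 1)"
      using False by (simp add: ladder_Suc[of k] mult.assoc)
    also have "\<dots> \<approx> coef (inv_into UNIV \<sigma> d) * coef a * rung (k + - 1)"
      by (intro gwa_class_cong gwa_class_relations refl)
    also have "\<dots> = gwa_class \<sigma> a (coef (inv_into UNIV \<sigma> d * a) * rung (k + - 1))"
      by (intro gwa_class_cong gwa_class_relations(2)[symmetric] refl)
    finally show ?thesis using comm False by simp
  qed
qed

lemma reducible_mult: "reducible s \<Longrightarrow> reducible (r * s)"
proof (induction r arbitrary: s rule: free_ring_induct)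
  case one
  then show ?case by simp
next
  case (letter u)
  then show ?case
    using reducible_act[OF _ coef_act] reducible_act[OF _ x_act] reducible_act[OF _ y_act]
    by (cases u) simp_all
next
  case (diff r r')
  have "reducible (coef (- 1) * (r' * s))"
    using reducible_act[OF _ coef_act] diff by simp
  moreover have "coef (- 1) * (r' * s) \<approx> - 1 * (r' * s)"
    by (intro gwa_class_cong coef_uminus_1 refl)
  ultimately have "reducible (- 1 * (r' * s))"
    using reducible_cong by metis
  with diff show ?case
    using reducible_add[of "r * s" "- 1 * (r' * s)"] by (simp add: left_diff_distrib)
next
  case (mult r r')
  then show ?case by (simp add: mult.assoc)
qed

theorem gwa_class_normal_form:
  obtains p K where "finite K" "gwa_class \<sigma> a r = gwa_class \<sigma> a (normal_form p K)"
proof -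
  have "1 \<approx> normal_form (\<lambda>_. 1) {0}"
    using gwa_class_relations(3)[of \<sigma> a] by (simp add: normal_form_def)
  then have "reducible 1" by (rule reducibleI) simp
  from reducible_mult[OF this, of r] that show ?thesis by (auto simp: reducible_def)
qed

end

section \<open>The defining ideal as a kernel\<close>

definition gwa_family :: "('d::ring_1 \<Rightarrow> 'd) \<Rightarrow> 'd \<Rightarrow> ('d gwa_letter \<Rightarrow> 's::ring_1) \<Rightarrow> bool" where
  "gwa_family \<sigma> a \<theta> \<longleftrightarrow>
    (\<forall>d e. \<theta> (Coef (d + e)) = \<theta> (Coef d) + \<theta> (Coef e)) \<and>
    (\<forall>d e. \<theta> (Coef (d * e)) = \<theta> (Coef d) * \<theta> (Coef e)) \<and>
    \<theta> (Coef 1) = 1 \<and>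
    \<theta> LetterX * \<theta> LetterY = \<theta> (Coef (\<sigma> a)) \<and>
    \<theta> LetterY * \<theta> LetterX = \<theta> (Coef a) \<and>
    (\<forall>d. \<theta> LetterX * \<theta> (Coef d) = \<theta> (Coef (\<sigma> d)) * \<theta> LetterX) \<and>
    (\<forall>d. \<theta> LetterY * \<theta> (Coef d) = \<theta> (Coef (inv_into UNIV \<sigma> d)) * \<theta> LetterY)"

lemma gwa_ideal_subset_kernel:
  assumes "gwa_family \<sigma> a \<theta>"
  shows "gwa_ideal \<sigma> a \<subseteq> {r. free_lift \<theta> r = 0}"
  unfolding gwa_ideal_def
proof (rule ring.genideal_minimal[OF ring_ring_of_type_algebra])
  show "ideal {r. free_lift \<theta> r = 0} ring_of_type_algebra"
  proof (rule idealI[OF ring_ring_of_type_algebra])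
    show "subgroup {r. free_lift \<theta> r = 0} (add_monoid ring_of_type_algebra)"
    proof -
      interpret ring "ring_of_type_algebra :: 'a gwa_letter free_ring ring"
        by (rule ring_ring_of_type_algebra)
      have neg: "\<ominus>\<^bsub>ring_of_type_algebra\<^esub> r = - r" for r :: "'a gwa_letter free_ring"
        using minus_equality[of "- r" r] by simp
      show ?thesis
        by (rule add.subgroupI) (auto simp: free_lift_add free_lift_0 free_lift_uminus neg simp flip: a_inv_def intro!: exI[of _ 0])
    qed
  qed (simp_all add: free_lift_mult)
  show "gwa_relations \<sigma> a \<subseteq> {r. free_lift \<theta> r = 0}"
    using assms
    by (auto simp: gwa_relations_def gwa_family_def Let_def free_lift_add free_lift_diff
        free_lift_mult free_lift_letter free_lift_1)
qed

lemma free_lift_power: "free_lift \<theta> (r ^ n) = free_lift \<theta> r ^ n"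
  by (induction n) (simp_all add: free_lift_1 free_lift_mult)

lemma free_lift_ladder:
  "free_lift \<theta> (ladder r s k) = ladder (free_lift \<theta> r) (free_lift \<theta> s) k"
  by (simp add: ladder_def free_lift_power)

lemma free_lift_sum: "free_lift \<theta> (sum f K) = (\<Sum>k\<in>K. free_lift \<theta> (f k))"
  by (induction K rule: infinite_finite_induct) (simp_all add: free_lift_0 free_lift_add)

lemma free_lift_normal_form:
  "free_lift \<theta> (normal_form p K) = (\<Sum>k\<in>K. \<theta> (Coef (p k)) * ladder (\<theta> LetterX) (\<theta> LetterY) k)"
  by (simp add: normal_form_def free_lift_sum free_lift_mult free_lift_ladder free_lift_letter)

lemma free_lift_cong:
  assumes "gwa_family \<sigma> a \<theta>" "gwa_class \<sigma> a r = gwa_class \<sigma> a s"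
  shows "free_lift \<theta> r = free_lift \<theta> s"
  using gwa_ideal_subset_kernel[OF assms(1)] assms(2) by (auto simp: gwa_class_eq_iff free_lift_diff)

definition independent_family :: "('d::ring_1 gwa_letter \<Rightarrow> 's::ring_1) \<Rightarrow> bool" where
  "independent_family \<theta> \<longleftrightarrow> (\<forall>p K. finite K \<longrightarrow>
    (\<Sum>k\<in>K. \<theta> (Coef (p k)) * ladder (\<theta> LetterX) (\<theta> LetterY) k) = 0 \<longrightarrow> (\<forall>k\<in>K. p k = 0))"

text \<open>
  An element of the kernel has a normal form in the kernel; independence makes all its coefficients
  zero, so that the element itself vanishes modulo the relations. In other words, the defining ideal
  is the whole kernel of the lift, and no explicit description of the ideal is required to recognize
  its elements.
\<close>

theorem free_lift_eq_iff:
  assumes "gwa_family \<sigma> a \<theta>" "independent_family \<theta>"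
  shows "free_lift \<theta> r = free_lift \<theta> s \<longleftrightarrow> gwa_class \<sigma> a r = gwa_class \<sigma> a s"
proof
  assume "free_lift \<theta> r = free_lift \<theta> s"
  then have "free_lift \<theta> (r - s) = 0" by (simp add: free_lift_diff)
  moreover obtain p K where K: "finite K" "gwa_class \<sigma> a (r - s) = gwa_class \<sigma> a (normal_form p K)"
    by (rule gwa_class_normal_form)
  ultimately have "free_lift \<theta> (normal_form p K) = 0"
    using free_lift_cong[OF assms(1)] by metis
  then have "\<forall>k\<in>K. p k = 0"
    using assms(2) K(1) by (simp add: free_lift_normal_form independent_family_def)
  then have "gwa_class \<sigma> a (normal_form p K) = gwa_class \<sigma> a (\<Sum>k\<in>K. 0 * ladder (letter LetterX) (letter LetterY) k)"
    unfolding normal_form_def by (intro gwa_class_sum_cong gwa_class_cong refl) (simp add: coef_0)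
  with K(2) have "gwa_class \<sigma> a (r - s) = gwa_class \<sigma> a 0" by simp
  then show "gwa_class \<sigma> a r = gwa_class \<sigma> a s" by (simp add: gwa_class_eq_iff)
qed (rule free_lift_cong[OF assms(1)])

lemma free_lift_range_normal_form:
  assumes "gwa_family \<sigma> a \<theta>"
  obtains p K where "finite K"
    "free_lift \<theta> r = (\<Sum>k\<in>K. \<theta> (Coef (p k)) * ladder (\<theta> LetterX) (\<theta> LetterY) k)"
  using gwa_class_normal_form[of \<sigma> a r] free_lift_cong[OF assms] free_lift_normal_form by metis

text \<open>
  The chosen representative is irrelevant when \<open>\<theta>\<close> satisfies the relations.
\<close>

definition gwa_lift :: "('d::ring_1 \<Rightarrow> 'd) \<Rightarrow> 'd \<Rightarrow> ('d gwa_letter \<Rightarrow> 's::ring_1) \<Rightarrow> 'd gwa_elt \<Rightarrow> 's" where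
  "gwa_lift \<sigma> a \<theta> c = free_lift \<theta> (SOME r. gwa_class \<sigma> a r = c)"

lemma gwa_lift_class:
  assumes "gwa_family \<sigma> a \<theta>"
  shows "gwa_lift \<sigma> a \<theta> (gwa_class \<sigma> a r) = free_lift \<theta> r"
  unfolding gwa_lift_def
  by (rule free_lift_cong[OF assms]) (rule someI[of "\<lambda>s. gwa_class \<sigma> a s = gwa_class \<sigma> a r"], rule refl)

section \<open>Triples that satisfy the relations of a classical generalized Weyl algebra\<close>

lemma shift_simps:
  "shift \<alpha> 0 = 0" "shift \<alpha> 1 = 1" "shift \<alpha> (p + q) = shift \<alpha> p + shift \<alpha> q"
  "shift \<alpha> (p * q) = shift \<alpha> p * shift \<alpha> q" "shift \<alpha> [:c:] = [:c:]"
  by (simp_all add: shift_def pcompose_add pcompose_mult pcompose_1)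

lemma shift_shift: "shift \<alpha> (shift \<beta> p) = shift (\<alpha> + \<beta>) p"
  by (simp add: shift_def pcompose_assoc[symmetric] pcompose_pCons algebra_simps)

lemma shift_zero [simp]: "shift 0 p = p"
  by (simp add: shift_def)

lemma inv_shift: "inv_into UNIV (shift \<alpha>) p = shift (- \<alpha>) p"
  by (rule inv_into_f_eq) (auto simp: inj_on_def shift_shift intro: injI dest: arg_cong[of _ _ "shift (- \<alpha>)"])

lemma shift_eq_0_iff [simp]: "shift \<alpha> p = 0 \<longleftrightarrow> p = 0"
  by (metis shift_shift shift_simps(1) shift_zero add.left_inverse)

text \<open>
  An associative unital algebra over a field, with the ring structure given by a type class, so that
  identities between noncommuting elements are accessible to rewriting.
\<close>

locale scalar_algebra = vector_space scale
  for scale :: "'k::field \<Rightarrow> 's::ring_1 \<Rightarrow> 's" (infixr "*s" 75) +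
  assumes scale_mult_left [simp]: "(c *s u) * v = c *s (u * v)"
    and scale_mult_right [simp]: "u * (c *s v) = c *s (u * v)"
begin

definition eval_at :: "'s \<Rightarrow> 'k poly \<Rightarrow> 's" where
  "eval_at z p = (\<Sum>i\<le>Polynomial.degree p. Polynomial.coeff p i *s z ^ i)"

lemma eval_at_eq_sum:
  assumes "Polynomial.degree p \<le> n"
  shows "eval_at z p = (\<Sum>i\<le>n. Polynomial.coeff p i *s z ^ i)"
  unfolding eval_at_def
  by (rule sum.mono_neutral_left) (use assms in \<open>auto simp: coeff_eq_0\<close>)

lemma eval_at_0 [simp]: "eval_at z 0 = 0"
  by (simp add: eval_at_def)

lemma eval_at_pCons: "eval_at z (pCons c p) = c *s 1 + z * eval_at z p"
proof -
  have "eval_at z (pCons c p) = (\<Sum>i\<le>Suc (Polynomial.degree p). Polynomial.coeff (pCons c p) i *s z ^ i)"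
    by (rule eval_at_eq_sum) (simp add: degree_pCons_le)
  then show ?thesis
    by (simp add: sum.atMost_Suc_shift eval_at_def sum_distrib_left del: sum.atMost_Suc)
qed

lemma eval_at_add: "eval_at z (p + q) = eval_at z p + eval_at z q"
proof -
  let ?n = "max (Polynomial.degree p) (Polynomial.degree q)"
  have "Polynomial.degree (p + q) \<le> ?n" by (rule degree_add_le) auto
  then show ?thesis
    by (simp add: eval_at_eq_sum[of _ ?n] scale_left_distrib sum.distrib)
qed

lemma eval_at_smult: "eval_at z (Polynomial.smult c p) = c *s eval_at z p"
  by (subst eval_at_eq_sum[of _ "Polynomial.degree p"])
    (simp_all add: eval_at_def scale_sum_right degree_smult_le)

lemma eval_at_mult: "eval_at z (p * q) = eval_at z p * eval_at z q"
  by (induction p)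
    (simp_all add: mult_pCons_left eval_at_add eval_at_smult eval_at_pCons distrib_right mult.assoc)

lemma eval_at_const [simp]: "eval_at z [:c:] = c *s 1"
  by (simp add: eval_at_pCons)

lemma eval_at_1 [simp]: "eval_at z 1 = 1"
  by (simp add: one_pCons)

lemma eval_at_var: "eval_at z [:0, 1:] = z"
  by (simp add: eval_at_pCons)

lemma commute_eval_at:
  assumes "x * z = (z - \<alpha> *s 1) * x"
  shows "x * eval_at z p = eval_at z (shift \<alpha> p) * x"
proof (induction p)
  case (pCons c p)
  have "shift \<alpha> (pCons c p) = [:c:] + [:- \<alpha>, 1:] * shift \<alpha> p"
    by (simp add: shift_def pcompose_pCons)
  then have "eval_at z (shift \<alpha> (pCons c p)) = c *s 1 + (z - \<alpha> *s 1) * eval_at z (shift \<alpha> p)"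
    by (simp only: eval_at_add eval_at_mult) (simp add: eval_at_pCons)
  moreover have "x * eval_at z (pCons c p) = c *s x + (z - \<alpha> *s 1) * (x * eval_at z p)"
    by (simp add: eval_at_pCons distrib_left assms flip: mult.assoc)
  ultimately show ?case
    using pCons by (simp add: distrib_right mult.assoc)
qed (simp add: shift_simps)

text \<open>
  The defining relations, with generators replaced by elements of an algebra and coefficients by
  evaluation at \<open>z\<close>. The relation for \<open>y\<close> is written with \<open>- (- \<alpha>)\<close> to have the same shape as the
  one for \<open>x\<close>.
\<close>

definition gwa_triple :: "'k \<Rightarrow> 'k poly \<Rightarrow> 's \<Rightarrow> 's \<Rightarrow> 's \<Rightarrow> bool" where
  "gwa_triple \<alpha> a x y z \<longleftrightarrow>
    x * z = (z - \<alpha> *s 1) * x \<and> y * z = (z - (- \<alpha>) *s 1) * y \<and>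
    y * x = eval_at z a \<and> x * y = eval_at z (shift \<alpha> a)"

definition gwa_subst :: "'s \<Rightarrow> 's \<Rightarrow> 's \<Rightarrow> 'k poly gwa_letter \<Rightarrow> 's" where
  "gwa_subst x y z u = (case u of Coef p \<Rightarrow> eval_at z p | LetterX \<Rightarrow> x | LetterY \<Rightarrow> y)"

lemma gwa_subst_simps [simp]:
  "gwa_subst x y z (Coef p) = eval_at z p" "gwa_subst x y z LetterX = x" "gwa_subst x y z LetterY = y"
  by (simp_all add: gwa_subst_def)

lemma gwa_family_triple:
  assumes "gwa_triple \<alpha> a x y z"
  shows "gwa_family (shift \<alpha>) a (gwa_subst x y z)"
  using assms commute_eval_at[of x z \<alpha>] commute_eval_at[of y z "- \<alpha>"]
  by (simp add: gwa_family_def gwa_triple_def eval_at_add eval_at_mult inv_shift)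

text \<open>
  In \<open>y\<^sup>n x\<^sup>n\<close> and \<open>x\<^sup>n y\<^sup>n\<close> the innermost factors combine to a polynomial in \<open>z\<close>, which then moves
  outwards by the commutation rule. For \<open>n\<close> the order of a diagonal automorphism this describes its
  fixed ring; for arbitrary \<open>n\<close> it shows that nonzero polynomials in \<open>z\<close> do not annihilate rungs.
\<close>

lemma gwa_triple_power:
  assumes "gwa_triple \<alpha> a x y z" "a \<noteq> 0"
  shows "\<exists>b. b \<noteq> 0 \<and> gwa_triple (of_nat n * \<alpha>) b (x ^ n) (y ^ n) z"
proof (induction n)
  case 0
  have "gwa_triple 0 1 1 1 z" by (simp add: gwa_triple_def shift_simps)
  then show ?case by (intro exI[of _ 1]) simp
next
  case (Suc n)
  then obtain b where b: "b \<noteq> 0" and T: "gwa_triple (of_nat n * \<alpha>) b (x ^ n) (y ^ n) z" by blast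
  let ?n = "of_nat n * \<alpha>" and ?b = "shift (- \<alpha>) b * a"
  have x: "x * z = (z - \<alpha> *s 1) * x" and y: "y * z = (z - (- \<alpha>) *s 1) * y"
    and YX: "y * x = eval_at z a" and XY: "x * y = eval_at z (shift \<alpha> a)"
    using assms(1) by (simp_all add: gwa_triple_def)
  have Xn: "x ^ n * z = (z - ?n *s 1) * x ^ n" and Yn: "y ^ n * z = (z - (- ?n) *s 1) * y ^ n"
    and YXn: "y ^ n * x ^ n = eval_at z b" and XYn: "x ^ n * y ^ n = eval_at z (shift ?n b)"
    using T by (simp_all add: gwa_triple_def)
  \<comment> \<open>Weights add up under multiplication.\<close>
  have move: "U * V * z = (z - (\<beta> + \<gamma>) *s 1) * (U * V)"
    if "U * z = (z - \<beta> *s 1) * U" "V * z = (z - \<gamma> *s 1) * V" for U V \<beta> \<gamma>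
  proof -
    have "U * V * z = U * z * V - \<gamma> *s (U * V)"
      by (simp add: that(2) mult.assoc left_diff_distrib right_diff_distrib)
    also have "\<dots> = (z - (\<beta> + \<gamma>) *s 1) * (U * V)"
      by (simp add: that(1) left_diff_distrib distrib_right mult.assoc scale_left_distrib)
    finally show ?thesis .
  qed
  have "y ^ Suc n * x ^ Suc n = y * (y ^ n * x ^ n) * x"
    by (simp add: mult.assoc power_Suc2[of x] del: power_Suc) (simp add: mult.assoc)
  also have "\<dots> = eval_at z (shift (- \<alpha>) b) * (y * x)"
    by (simp add: YXn commute_eval_at[OF y] mult.assoc)
  finally have "y ^ Suc n * x ^ Suc n = eval_at z ?b"
    by (simp add: YX eval_at_mult)
  moreover have "x ^ Suc n * y ^ Suc n = x ^ n * (x * y) * y ^ n"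
    by (simp add: mult.assoc power_Suc2[of x] del: power_Suc) (simp add: mult.assoc)
  then have "x ^ Suc n * y ^ Suc n = eval_at z (shift ?n (shift \<alpha> a)) * (x ^ n * y ^ n)"
    by (simp add: XY commute_eval_at[OF Xn] mult.assoc)
  then have "x ^ Suc n * y ^ Suc n = eval_at z (shift (of_nat (Suc n) * \<alpha>) ?b)"
    by (simp add: XYn eval_at_mult[symmetric] shift_simps shift_shift algebra_simps)
  moreover have "x ^ Suc n * z = (z - (of_nat (Suc n) * \<alpha>) *s 1) * x ^ Suc n"
    using move[OF x Xn] by (simp add: algebra_simps)
  moreover have "y ^ Suc n * z = (z - (- (of_nat (Suc n) * \<alpha>)) *s 1) * y ^ Suc n"
    using move[OF y Yn] by (simp add: algebra_simps)
  moreover have "?b \<noteq> 0" using b assms(2) by simp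
  ultimately show ?case unfolding gwa_triple_def by blast
qed

definition transcendental :: "'s \<Rightarrow> bool" where
  "transcendental z \<longleftrightarrow> (\<forall>p. eval_at z p = 0 \<longrightarrow> p = 0)"

text \<open>
  Equivalently \<open>[z, u] = \<alpha> u\<close>.
\<close>

definition weight :: "'s \<Rightarrow> 'k \<Rightarrow> 's \<Rightarrow> bool" where
  "weight z \<alpha> u \<longleftrightarrow> u * z = (z - \<alpha> *s 1) * u"

text \<open>
  Eigenvectors of \<open>ad z\<close> for distinct eigenvalues are linearly independent: the operator
  \<open>ad z - \<beta> j\<close> removes the \<open>j\<close>-th term of a vanishing sum and rescales the other terms by nonzero factors.
\<close>

lemma weight_vectors_independent:
  assumes "finite K" "inj_on \<beta> K" "\<And>k. k \<in> K \<Longrightarrow> weight z (\<beta> k) (T k)" "(\<Sum>k\<in>K. T k) = 0" "k \<in> K"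
  shows "T k = 0"
  using assms
proof (induction K arbitrary: T k rule: finite_induct)
  case (insert j K)
  have w: "z * T i - T i * z - \<beta> j *s T i = (\<beta> i - \<beta> j) *s T i" if "i \<in> insert j K" for i
    using insert.prems(2)[OF that] by (simp add: weight_def left_diff_distrib scale_left_diff_distrib)
  have "(\<Sum>i\<in>insert j K. (\<beta> i - \<beta> j) *s T i)
      = (\<Sum>i\<in>insert j K. z * T i - T i * z - \<beta> j *s T i)"
    using w by (intro sum.cong) simp_all
  also have "\<dots> = z * (\<Sum>i\<in>insert j K. T i) - (\<Sum>i\<in>insert j K. T i) * z - \<beta> j *s (\<Sum>i\<in>insert j K. T i)"
    by (simp only: sum_distrib_left sum_distrib_right sum_subtractf scale_sum_right)
  also have "\<dots> = 0" using insert.prems(3) by simp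
  finally have sum0: "(\<Sum>i\<in>K. (\<beta> i - \<beta> j) *s T i) = 0"
    using insert.hyps by simp
  have zero: "T i = 0" if "i \<in> K" for i
  proof -
    have "(\<beta> i - \<beta> j) *s T i = 0"
    proof (rule insert.IH[OF _ _ sum0 that])
      show "inj_on \<beta> K" using insert.prems(1) by (rule inj_on_subset) blast
      fix i assume "i \<in> K"
      then have "weight z (\<beta> i) (T i)" using insert.prems(2) by simp
      then show "weight z (\<beta> i) ((\<beta> i - \<beta> j) *s T i)" by (simp add: weight_def)
    qed
    moreover have "\<beta> i \<noteq> \<beta> j"
      using insert.prems(1) insert.hyps(2) that by (auto simp: inj_on_def)
    ultimately show ?thesis by simp
  qed
  then have "(\<Sum>i\<in>K. T i) = 0" by simp
  with insert.prems(3) insert.hyps have "T j = 0" by simp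
  with zero insert.prems(4) show ?case by blast
qed simp

text \<open>
  A nonzero shift gives the rungs distinct weights in characteristic zero, and transcendence of \<open>z\<close>
  keeps the coefficients visible.
\<close>

definition faithful_triple :: "'k \<Rightarrow> 'k poly \<Rightarrow> 's \<Rightarrow> 's \<Rightarrow> 's \<Rightarrow> bool" where
  "faithful_triple \<alpha> a x y z \<longleftrightarrow> \<alpha> \<noteq> 0 \<and> a \<noteq> 0 \<and> gwa_triple \<alpha> a x y z \<and> transcendental z"

lemma ladder_weight:
  assumes "gwa_triple \<alpha> a x y z" "a \<noteq> 0"
  shows "weight z (of_int k * \<alpha>) (ladder x y k)"
proof (cases "k \<ge> 0")
  case True
  obtain b where "gwa_triple (of_nat (nat k) * \<alpha>) b (x ^ nat k) (y ^ nat k) z"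
    using gwa_triple_power[OF assms] by blast
  with True show ?thesis by (simp add: ladder_def weight_def gwa_triple_def)
next
  case False
  obtain b where "gwa_triple (of_nat (nat (- k)) * \<alpha>) b (x ^ nat (- k)) (y ^ nat (- k)) z"
    using gwa_triple_power[OF assms] by blast
  with False show ?thesis by (simp add: ladder_def weight_def gwa_triple_def)
qed

lemma weight_eval_at_mult:
  assumes "weight z \<beta> u"
  shows "weight z \<beta> (eval_at z p * u)"
proof -
  have "z * eval_at z p = eval_at z p * z"
    using commute_eval_at[of z z 0 p] by simp
  with assms show ?thesis
    by (simp add: weight_def left_diff_distrib right_diff_distrib mult.assoc)
      (simp flip: mult.assoc)
qed

text \<open>
  Multiplication by the opposite rung turns a rung into a nonzero polynomial in \<open>z\<close>.
\<close>

lemma eval_at_mult_ladder_eq_0: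
  assumes "faithful_triple \<alpha> a x y z" "eval_at z p * ladder x y k = 0"
  shows "p = 0"
proof -
  have T: "gwa_triple \<alpha> a x y z" "a \<noteq> 0" and tr: "transcendental z"
    using assms(1) by (simp_all add: faithful_triple_def)
  define n where "n = nat \<bar>k\<bar>"
  obtain b where b: "b \<noteq> 0" "gwa_triple (of_nat n * \<alpha>) b (x ^ n) (y ^ n) z"
    using gwa_triple_power[OF T] by blast
  have "\<exists>q. q \<noteq> 0 \<and> ladder x y k * ladder x y (- k) = eval_at z q"
    using b by (auto simp: ladder_def n_def gwa_triple_def
        intro: exI[of _ b] exI[of _ "shift (of_nat n * \<alpha>) b"])
  then obtain q where q: "q \<noteq> 0" "ladder x y k * ladder x y (- k) = eval_at z q" by blast
  have "eval_at z (p * q) = eval_at z p * ladder x y k * ladder x y (- k)"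
    by (simp add: eval_at_mult q(2) mult.assoc)
  then have "eval_at z (p * q) = 0" using assms(2) by simp
  with tr q(1) show ?thesis by (auto simp: transcendental_def)
qed

end

locale scalar_algebra_char_0 = scalar_algebra scale
  for scale :: "'k::field_char_0 \<Rightarrow> 's::ring_1 \<Rightarrow> 's" (infixr "*s" 75)
begin

text \<open>
  The terms of a normal form have distinct weights, so a vanishing normal form vanishes term by term.
\<close>

lemma normal_form_components_eq_0:
  assumes F: "faithful_triple \<alpha> a x y z" and "finite K"
    and "(\<Sum>k\<in>K. eval_at z (p k) * ladder x y k) = 0" and "k \<in> K"
  shows "p k = 0"
proof -
  have \<alpha>: "\<alpha> \<noteq> 0" and T: "gwa_triple \<alpha> a x y z" "a \<noteq> 0"
    using F by (simp_all add: faithful_triple_def)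
  have "inj_on (\<lambda>k. of_int k * \<alpha>) K" using \<alpha> by (simp add: inj_on_def)
  from weight_vectors_independent[OF \<open>finite K\<close> this
      weight_eval_at_mult[OF ladder_weight[OF T]] assms(3,4)]
  have "eval_at z (p k) * ladder x y k = 0" .
  then show ?thesis by (rule eval_at_mult_ladder_eq_0[OF F])
qed

lemma independent_family_triple:
  "faithful_triple \<alpha> a x y z \<Longrightarrow> independent_family (gwa_subst x y z)"
  using normal_form_components_eq_0 by (force simp: independent_family_def)

end

context scalar_algebra
begin

definition subalgebra :: "'s set \<Rightarrow> bool" where
  "subalgebra S \<longleftrightarrow> 1 \<in> S \<and> (\<forall>u\<in>S. \<forall>v\<in>S. u - v \<in> S) \<and> (\<forall>u\<in>S. \<forall>v\<in>S. u * v \<in> S) \<and> (\<forall>c. \<forall>u\<in>S. c *s u \<in> S)"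

lemma subalgebra_closed:
  assumes "subalgebra S"
  shows "1 \<in> S" "0 \<in> S" "u \<in> S \<Longrightarrow> v \<in> S \<Longrightarrow> u + v \<in> S" "u \<in> S \<Longrightarrow> v \<in> S \<Longrightarrow> u - v \<in> S"
    "u \<in> S \<Longrightarrow> v \<in> S \<Longrightarrow> u * v \<in> S" "u \<in> S \<Longrightarrow> c *s u \<in> S"
proof -
  show "1 \<in> S" "u \<in> S \<Longrightarrow> v \<in> S \<Longrightarrow> u - v \<in> S" "u \<in> S \<Longrightarrow> v \<in> S \<Longrightarrow> u * v \<in> S" "u \<in> S \<Longrightarrow> c *s u \<in> S"
    using assms by (simp_all add: subalgebra_def)
  have "1 - 1 \<in> S" using assms unfolding subalgebra_def by blast
  then show "0 \<in> S" by simp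
  show "u + v \<in> S" if "u \<in> S" "v \<in> S"
  proof -
    have "u - (0 - v) \<in> S" using assms \<open>0 \<in> S\<close> that unfolding subalgebra_def by blast
    then show ?thesis by simp
  qed
qed

lemma subalgebra_sum:
  assumes "subalgebra S" "\<And>k. k \<in> K \<Longrightarrow> f k \<in> S"
  shows "sum f K \<in> S"
  using assms(2) by (induction K rule: infinite_finite_induct) (simp_all add: subalgebra_closed[OF assms(1)])

lemma subalgebra_power: "subalgebra S \<Longrightarrow> u \<in> S \<Longrightarrow> u ^ n \<in> S"
  by (induction n) (simp_all add: subalgebra_closed)

lemma subalgebra_eval_at: "subalgebra S \<Longrightarrow> z \<in> S \<Longrightarrow> eval_at z p \<in> S"
  unfolding eval_at_def by (intro subalgebra_sum subalgebra_closed subalgebra_power)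

lemma subalgebra_ladder: "subalgebra S \<Longrightarrow> x \<in> S \<Longrightarrow> y \<in> S \<Longrightarrow> ladder x y k \<in> S"
  by (simp add: ladder_def subalgebra_power)

abbreviation generated :: "'s \<Rightarrow> 's \<Rightarrow> 's \<Rightarrow> 's set" where
  "generated x y z \<equiv> range (free_lift (gwa_subst x y z))"

lemma generated_subset:
  assumes "subalgebra S" "x \<in> S" "y \<in> S" "z \<in> S"
  shows "generated x y z \<subseteq> S"
proof -
  have "gwa_subst x y z u \<in> S" for u
    using assms by (cases u) (simp_all add: subalgebra_eval_at)
  then have "free_lift (gwa_subst x y z) r \<in> S" for r
    by (induction r rule: free_ring_induct)
      (simp_all add: free_lift_1 free_lift_letter free_lift_diff free_lift_mult subalgebra_closed[OF assms(1)])
  then show ?thesis by blast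
qed

lemma subalgebra_generated: "subalgebra (generated x y z)"
proof -
  let ?l = "free_lift (gwa_subst x y z)"
  have "1 \<in> range ?l" using free_lift_1 by (metis rangeI)
  moreover have "c *s ?l r = ?l (letter (Coef [:c:]) * r)" for c r
    by (simp add: free_lift_mult free_lift_letter)
  ultimately show ?thesis
    by (auto simp: subalgebra_def simp flip: free_lift_diff free_lift_mult)
qed

lemma generators_in_generated: "x \<in> generated x y z" "y \<in> generated x y z" "z \<in> generated x y z"
proof -
  have "gwa_subst x y z u \<in> generated x y z" for u
    by (metis free_lift_letter rangeI)
  from this[of LetterX] this[of LetterY] this[of "Coef [:0, 1:]"]
  show "x \<in> generated x y z" "y \<in> generated x y z" "z \<in> generated x y z"
    by (simp_all add: eval_at_var)
qed

end

section \<open>Realizations of presented algebras\<close>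

lemma cgwa_ops [simp]:
  "carrier (cgwa \<alpha> a) = range (gwa_class (shift \<alpha>) a)"
  "u \<otimes>\<^bsub>cgwa \<alpha> a\<^esub> v = u \<otimes>\<^bsub>gwa (shift \<alpha>) a\<^esub> v" "u \<oplus>\<^bsub>cgwa \<alpha> a\<^esub> v = u \<oplus>\<^bsub>gwa (shift \<alpha>) a\<^esub> v"
  "\<one>\<^bsub>cgwa \<alpha> a\<^esub> = gwa_class (shift \<alpha>) a 1"
  "c \<odot>\<^bsub>cgwa \<alpha> a\<^esub> u = cgwa_coef \<alpha> a [:c:] \<otimes>\<^bsub>gwa (shift \<alpha>) a\<^esub> u"
  by (simp_all add: cgwa_def ring.defs module.defs carrier_gwa gwa_class_hom)

context scalar_algebra_char_0
begin

text \<open>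
  The embedding of the presented algebra with image \<open>generated x y z\<close>.
\<close>

definition realize :: "'k \<Rightarrow> 'k poly \<Rightarrow> 's \<Rightarrow> 's \<Rightarrow> 's \<Rightarrow> 'k poly gwa_elt \<Rightarrow> 's" where
  "realize \<alpha> a x y z = gwa_lift (shift \<alpha>) a (gwa_subst x y z)"

context
  fixes \<alpha> a x y z
  assumes F: "faithful_triple \<alpha> a x y z"
begin

lemma realize_class:
  "realize \<alpha> a x y z (gwa_class (shift \<alpha>) a r) = free_lift (gwa_subst x y z) r"
  using F unfolding realize_def faithful_triple_def by (simp add: gwa_lift_class gwa_family_triple)

lemma realize_hom:
  assumes "u \<in> carrier (cgwa \<alpha> a)" "v \<in> carrier (cgwa \<alpha> a)"
  shows "realize \<alpha> a x y z (u \<otimes>\<^bsub>cgwa \<alpha> a\<^esub> v) = realize \<alpha> a x y z u * realize \<alpha> a x y z v"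
    and "realize \<alpha> a x y z (u \<oplus>\<^bsub>cgwa \<alpha> a\<^esub> v) = realize \<alpha> a x y z u + realize \<alpha> a x y z v"
    and "u \<otimes>\<^bsub>cgwa \<alpha> a\<^esub> v \<in> carrier (cgwa \<alpha> a)" "u \<oplus>\<^bsub>cgwa \<alpha> a\<^esub> v \<in> carrier (cgwa \<alpha> a)"
  using assms by (auto simp: gwa_class_hom realize_class free_lift_mult free_lift_add)

lemma realize_scale:
  assumes "u \<in> carrier (cgwa \<alpha> a)"
  shows "realize \<alpha> a x y z (c \<odot>\<^bsub>cgwa \<alpha> a\<^esub> u) = c *s realize \<alpha> a x y z u"
    and "c \<odot>\<^bsub>cgwa \<alpha> a\<^esub> u \<in> carrier (cgwa \<alpha> a)"
  using assms
  by (auto simp: gwa_class_hom realize_class free_lift_mult cgwa_coef_def free_lift_letter)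

lemma realize_simps:
  "realize \<alpha> a x y z \<one>\<^bsub>cgwa \<alpha> a\<^esub> = 1" "realize \<alpha> a x y z (cgwa_x \<alpha> a) = x"
  "realize \<alpha> a x y z (cgwa_y \<alpha> a) = y" "realize \<alpha> a x y z (cgwa_z \<alpha> a) = z"
  by (simp_all add: realize_class free_lift_1 free_lift_letter cgwa_x_def cgwa_y_def cgwa_z_def
      cgwa_coef_def eval_at_var)

lemma cgwa_generators_in_carrier:
  "\<one>\<^bsub>cgwa \<alpha> a\<^esub> \<in> carrier (cgwa \<alpha> a)" "cgwa_x \<alpha> a \<in> carrier (cgwa \<alpha> a)"
  "cgwa_y \<alpha> a \<in> carrier (cgwa \<alpha> a)" "cgwa_z \<alpha> a \<in> carrier (cgwa \<alpha> a)"
  by (simp_all add: cgwa_x_def cgwa_y_def cgwa_z_def cgwa_coef_def)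

lemma realize_bij: "bij_betw (realize \<alpha> a x y z) (carrier (cgwa \<alpha> a)) (generated x y z)"
  unfolding bij_betw_def
proof
  have fam: "gwa_family (shift \<alpha>) a (gwa_subst x y z)"
    using F by (simp add: faithful_triple_def gwa_family_triple)
  show "inj_on (realize \<alpha> a x y z) (carrier (cgwa \<alpha> a))"
    using free_lift_eq_iff[OF fam independent_family_triple[OF F]]
    by (auto simp: inj_on_def realize_class)
  show "realize \<alpha> a x y z ` carrier (cgwa \<alpha> a) = generated x y z"
    by (auto simp: image_image realize_class)
qed

end

text \<open>
  Both presented algebras embed in the same ring. If the second image is the image of a
  subset \<open>K\<close> of the first algebra, then composing one embedding with the inverse of the other is an
  isomorphism onto \<open>K\<close>; all the structure is compared inside the common ring.
\<close>

theorem cgwa_iso_of_generated: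
  assumes F: "faithful_triple \<alpha> a x y z" and G: "faithful_triple \<beta> b U V W"
    and K: "K \<subseteq> carrier (cgwa \<alpha> a)" "realize \<alpha> a x y z ` K = generated U V W"
  shows "\<exists>\<phi>\<in>alg_iso (cgwa \<beta> b) (cgwa \<alpha> a\<lparr>carrier := K\<rparr>).
    \<forall>u\<in>carrier (cgwa \<beta> b). realize \<alpha> a x y z (\<phi> u) = realize \<beta> b U V W u"
proof -
  let ?R = "cgwa \<alpha> a" and ?S = "cgwa \<beta> b"
  let ?i = "realize \<alpha> a x y z" and ?j = "realize \<beta> b U V W"
  define \<phi> where "\<phi> = inv_into K ?i \<circ> ?j"
  have inj: "inj_on ?i (carrier ?R)"
    using realize_bij[OF F] by (simp add: bij_betw_def)
  then have bijK: "bij_betw ?i K (generated U V W)"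
    using K inj_on_subset by (auto simp: bij_betw_def)
  have bij: "bij_betw \<phi> (carrier ?S) K"
    unfolding \<phi>_def by (rule bij_betw_trans[OF realize_bij[OF G] bij_betw_inv_into[OF bijK]])
  have mem: "\<phi> u \<in> K" if "u \<in> carrier ?S" for u
    using bij that by (rule bij_betw_apply)
  then have memR: "\<phi> u \<in> carrier ?R" if "u \<in> carrier ?S" for u
    using K(1) that by blast
  have ij: "?i (\<phi> u) = ?j u" if "u \<in> carrier ?S" for u
    unfolding \<phi>_def comp_def
    by (rule bij_betw_inv_into_right[OF bijK bij_betw_apply[OF realize_bij[OF G] that]])
  have eq: "\<phi> u = v" if "u \<in> carrier ?S" "v \<in> carrier ?R" "?j u = ?i v" for u v
    by (rule inj_onD[OF inj _ memR[OF that(1)] that(2)]) (simp only: ij[OF that(1)] that(3))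
  have mult: "\<phi> (u \<otimes>\<^bsub>?S\<^esub> v) = \<phi> u \<otimes>\<^bsub>?R\<^esub> \<phi> v" if "u \<in> carrier ?S" "v \<in> carrier ?S" for u v
    using that by (intro eq) (simp_all only: realize_hom[OF F] realize_hom[OF G] memR ij)
  have add: "\<phi> (u \<oplus>\<^bsub>?S\<^esub> v) = \<phi> u \<oplus>\<^bsub>?R\<^esub> \<phi> v" if "u \<in> carrier ?S" "v \<in> carrier ?S" for u v
    using that by (intro eq) (simp_all only: realize_hom[OF F] realize_hom[OF G] memR ij)
  have scale: "\<phi> (c \<odot>\<^bsub>?S\<^esub> u) = c \<odot>\<^bsub>?R\<^esub> \<phi> u" if "u \<in> carrier ?S" for c u
    using that by (intro eq) (simp_all only: realize_scale[OF F] realize_scale[OF G] memR ij)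
  have one: "\<phi> \<one>\<^bsub>?S\<^esub> = \<one>\<^bsub>?R\<^esub>"
    by (intro eq) (simp_all only: cgwa_generators_in_carrier[OF F] cgwa_generators_in_carrier[OF G]
        realize_simps[OF F] realize_simps[OF G])
  have "\<phi> \<in> alg_iso ?S (?R\<lparr>carrier := K\<rparr>)"
    unfolding alg_iso_def ring_iso_def ring_hom_def
    using mem mult add scale one bij by (simp del: cgwa_ops)
  with ij show ?thesis by blast
qed

end

section \<open>Standard bases of a copy of \<open>sl\<^sub>2\<close>\<close>

context scalar_algebra_char_0
begin

text \<open>
  The relations imply \<open>[x, y] = - 2 h\<close>, so that \<open>x, y, h\<close> satisfy the commutation relations of a
  standard basis of \<open>sl\<^sub>2\<close>; beyond that they fix the value of the Casimir element \<open>y x - h\<^sup>2 - h\<close> to be the scalar \<open>c\<close>.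
\<close>

definition sl2_triple :: "'k \<Rightarrow> 's \<Rightarrow> 's \<Rightarrow> 's \<Rightarrow> bool" where
  "sl2_triple c x y h \<longleftrightarrow> h * x = x * h + x \<and> h * y = y * h - y \<and>
    y * x = h * h + h + c *s 1 \<and> x * y = h * h - h + c *s 1"

definition comb :: "'s \<Rightarrow> 's \<Rightarrow> 's \<Rightarrow> 'k \<Rightarrow> 'k \<Rightarrow> 'k \<Rightarrow> 's" where
  "comb x y h p q r = p *s x + q *s y + r *s h"

lemma span3: "u \<in> span {x, y, h} \<longleftrightarrow> (\<exists>p q r. u = comb x y h p q r)"
proof -
  have "u \<in> span {x, y, h} \<longleftrightarrow> (\<exists>p q r. u - p *s x - q *s y = r *s h)"
    by (auto simp: span_insert span_singleton)
  also have "\<dots> \<longleftrightarrow> (\<exists>p q r. u = comb x y h p q r)"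
    by (simp add: comb_def algebra_simps)
  finally show ?thesis .
qed

lemma comb_mult:
  assumes "sl2_triple c x y h"
  shows "comb x y h p q r * comb x y h p' q' r' =
    (p * p') *s (x * x) + (q * q') *s (y * y) + (p * r' + r * p') *s (x * h) + (q * r' + r * q') *s (y * h)
    + (r * r' + p * q' + q * p') *s (h * h) + comb x y h (r * p') (- (r * q')) (q * p' - p * q')
    + (c * (p * q' + q * p')) *s 1"
proof -
  have rel: "h * x = x * h + x" "h * y = y * h - y" "y * x = h * h + h + c *s 1" "x * y = h * h - h + c *s 1"
    using assms by (simp_all add: sl2_triple_def)
  show ?thesis
    unfolding comb_def by (simp add: rel algebra_simps)
qed

lemma comb_bracket:
  assumes "sl2_triple c x y h"
  shows "comb x y h p q r * comb x y h p' q' r' - comb x y h p' q' r' * comb x y h p q r =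
    comb x y h (r * p' - p * r') (q * r' - r * q') ((q * p' - p * q') + (q * p' - p * q'))"
proof -
  have double: "comb x y h u v (w + w) = comb x y h u v w + w *s h" for u v w
    by (simp only: comb_def scale_left_distrib add.assoc)
  show ?thesis
    unfolding double comb_mult[OF assms] by (simp add: comb_def algebra_simps)
qed

lemma comb_scale: "k *s comb x y h p q r = comb x y h (k * p) (k * q) (k * r)"
  by (simp add: comb_def algebra_simps)

lemma comb_basis: "comb x y h 1 0 0 = x" "comb x y h 0 1 0 = y" "comb x y h 0 0 1 = h"
  by (simp_all add: comb_def)

text \<open>
  The space \<open>L\<close> and the scalar \<open>c\<close> stay the same while the basis varies.
\<close>

definition sl2_frame :: "'k \<Rightarrow> 's set \<Rightarrow> 's \<Rightarrow> 's \<Rightarrow> 's \<Rightarrow> bool" where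
  "sl2_frame c L x y h \<longleftrightarrow> sl2_triple c x y h \<and> span {x, y, h} = L"

lemma frame_swap: "sl2_frame c L x y h \<Longrightarrow> sl2_frame c L y x (- h)"
proof -
  assume F: "sl2_frame c L x y h"
  then have "sl2_triple c y x (- h)" by (simp add: sl2_frame_def sl2_triple_def)
  moreover have "h \<in> span {y, x, - h}" using span_neg[OF span_base[of "- h" "{y, x, - h}"]] by simp
  then have "span {y, x, - h} = span {x, y, h}"
    by (simp add: span_eq span_base span_neg)
  ultimately show ?thesis using F by (simp add: sl2_frame_def)
qed

text \<open>
  The new basis is the image of the old one under the inner automorphism \<open>exp (- s ad x)\<close>.
\<close>

lemma frame_shear:
  assumes F: "sl2_frame c L x y h"
  shows "sl2_frame c L x (y + s *s h + s *s h + (s * s) *s x) (h + s *s x)"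
proof -
  have rel: "h * x = x * h + x" "h * y = y * h - y" "y * x = h * h + h + c *s 1" "x * y = h * h - h + c *s 1"
    using F by (simp_all add: sl2_frame_def sl2_triple_def)
  have "sl2_triple c x (y + s *s h + s *s h + (s * s) *s x) (h + s *s x)"
    by (simp add: sl2_triple_def rel algebra_simps)
  moreover have sub: "span {u, v + s *s w + s *s w + (s * s) *s u, w + s *s u} \<subseteq> span {u, v, w}" for u v w s
    by (rule span_minimal) (simp_all add: span_add span_scale span_base)
  \<comment> \<open>The inverse of the shear by \<open>s\<close> is the shear by \<open>- s\<close>.\<close>
  have "span {x, y, h} \<subseteq> span {x, y + s *s h + s *s h + (s * s) *s x, h + s *s x}"
    using sub[of x "y + s *s h + s *s h + (s * s) *s x" "- s" "h + s *s x"]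
    by (simp add: algebra_simps)
  with sub[of x y s h] have "span {x, y + s *s h + s *s h + (s * s) *s x, h + s *s x} = span {x, y, h}"
    by blast
  ultimately show ?thesis using F by (simp add: sl2_frame_def)
qed

lemma frame_shear_coordinates:
  "comb x y h p q r = comb x (y + s *s h + s *s h + (s * s) *s x) (h + s *s x) (p + q * s * s - r * s) q (r - q * s - q * s)"
proof -
  have r: "(r - q * s - q * s) *s w = r *s w - (q * s) *s w - (q * s) *s w" for w
    by (simp only: scale_left_diff_distrib)
  show ?thesis unfolding comb_def r by (simp add: algebra_simps)
qed

text \<open>
  A shear along \<open>y\<close> is a shear along \<open>x\<close> between two swaps.
\<close>

lemma frame_semisimple_lower:
  assumes "sl2_frame c L x y h"
  shows "\<exists>x' y'. sl2_frame c L x' y' (comb x y h 0 q 1)"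
proof -
  have "\<exists>y'. sl2_frame c L y y' (- h + (- q) *s y)"
    using frame_shear[OF frame_swap[OF assms]] by blast
  then obtain y' where "sl2_frame c L y y' (- h + (- q) *s y)" ..
  from frame_swap[OF this] show ?thesis by (auto simp: comb_def add.commute)
qed

text \<open>
  The discriminant \<open>r\<^sup>2 - 4 p q\<close> is, up to a constant factor, the Killing form of the element. A shear
  whose parameter solves a quadratic equation removes the \<open>x\<close>-component; discriminant 1 then leaves \<open>h\<close>
  with coefficient 1 and possibly some multiple of \<open>y\<close>, which a second shear removes.
\<close>

lemma frame_semisimple:
  assumes F: "sl2_frame c L x y h" and disc: "r * r - 4 * p * q = 1"
  shows "\<exists>x' y'. sl2_frame c L x' y' (comb x y h p q r)"
proof (cases "q = 0")
  case True
  then have "r = 1 \<or> r = - 1" using disc by (simp add: square_eq_1_iff)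
  then show ?thesis
  proof
    assume "r = 1"
    with True have "comb x y h p q r = h + p *s x" by (simp add: comb_def)
    with frame_shear[OF F, of p] show ?thesis by auto
  next
    assume "r = - 1"
    with True have "comb x y h p q r = comb y x (- h) 0 p 1" by (simp add: comb_def)
    with frame_semisimple_lower[OF frame_swap[OF F]] show ?thesis by simp
  qed
next
  case False
  \<comment> \<open>The root of \<open>p - r s + q s\<^sup>2\<close> for which the new coefficient of \<open>h\<close> is 1.\<close>
  define s where "s = (r - 1) / (2 * q)"
  have r: "r - q * s - q * s = 1" using False by (simp add: s_def field_simps)
  have p: "p = (r * r - 1) / (4 * q)" using disc False by (simp add: field_simps)
  have "p + q * s * s - r * s = 0" unfolding s_def by (subst p) (use False in \<open>simp add: field_simps\<close>)
  with r frame_shear_coordinates[of x y h p q r s] frame_semisimple_lower[OF frame_shear[OF F, of s]]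
  show ?thesis by simp
qed

text \<open>
  With discriminant zero, the shear at the double root leaves only a multiple of \<open>y\<close>.
\<close>

lemma frame_nilpotent:
  assumes F: "sl2_frame c L x y h" and disc: "r * r = 4 * p * q"
  shows "\<exists>k x' y' h'. sl2_frame c L x' y' h' \<and> comb x y h p q r = k *s x'"
proof (cases "q = 0")
  case True
  then have "comb x y h p q r = p *s x" using disc by (simp add: comb_def)
  with F show ?thesis by blast
next
  case False
  define s where "s = r / (2 * q)"
  have "r - q * s - q * s = 0" using False by (simp add: s_def field_simps)
  moreover have p: "p = r * r / (4 * q)" using disc False by (simp add: field_simps)
  have "p + q * s * s - r * s = 0" unfolding s_def by (subst p) (use False in \<open>simp add: field_simps\<close>)
  ultimately have "comb x y h p q r = q *s (y + s *s h + s *s h + (s * s) *s x)"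
    using frame_shear_coordinates[of x y h p q r s] by (simp add: comb_def)
  with frame_swap[OF frame_shear[OF F, of s]] show ?thesis by metis
qed

text \<open>
  If one of \<open>x, y, h\<close> vanished, the commutators would force all of them to vanish. Brackets with \<open>h\<close>
  then separate the three components.
\<close>

lemma frame_independent:
  assumes F: "sl2_frame c L x y h" and L: "L \<noteq> {0}" and zero: "comb x y h p q r = 0"
  shows "p = 0" "q = 0" "r = 0"
proof -
  have T: "sl2_triple c x y h" using F by (simp add: sl2_frame_def)
  have hx: "h * x - x * h = x" and hy: "h * y - y * h = - y" and xy: "h + h = y * x - x * y"
    using T by (simp_all add: sl2_triple_def algebra_simps)
  have "x \<noteq> 0 \<or> y \<noteq> 0 \<or> h \<noteq> 0"
    using F L by (auto simp: sl2_frame_def)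
  moreover have double: "u = 0" if "u + u = 0" for u :: 's
  proof -
    have "2 *s u = u + u" by (simp only: one_add_one[symmetric] scale_left_distrib scale_one)
    with that show ?thesis by simp
  qed
  moreover have "h = 0" if "x = 0 \<or> y = 0"
    by (rule double) (use that in \<open>auto simp only: xy mult_zero_left mult_zero_right diff_self\<close>)
  moreover have "x = 0 \<and> y = 0" if "h = 0"
    using hx hy unfolding that by simp
  ultimately have nz: "x \<noteq> 0" "y \<noteq> 0" "h \<noteq> 0" by blast+
  have bracket_comb: "h * comb x y h s t v - comb x y h s t v * h = comb x y h s (- t) 0" for s t v
    using comb_bracket[OF T, of 0 0 1 s t v] by (simp add: comb_def)
  have "comb x y h p (- q) 0 = 0" using bracket_comb[of p q r] zero by simp
  moreover from this have "comb x y h p q 0 = 0" using bracket_comb[of p "- q" 0] by simp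
  ultimately have "comb x y h p q 0 + comb x y h p (- q) 0 = 0" "comb x y h p q 0 = 0" by simp_all
  then have "p *s x + p *s x = 0" "p *s x + q *s y = 0"
    by (simp_all add: comb_def algebra_simps)
  from double[OF this(1)] nz show "p = 0" by simp
  with \<open>p *s x + q *s y = 0\<close> nz show "q = 0" by simp
  with \<open>p = 0\<close> zero nz show "r = 0" by (simp add: comb_def)
qed

lemma frame_eq_iff:
  assumes F: "sl2_frame c L x y h" and L: "L \<noteq> {0}"
  shows "comb x y h p q r = comb x y h p' q' r' \<longleftrightarrow> p = p' \<and> q = q' \<and> r = r'"
proof
  assume "comb x y h p q r = comb x y h p' q' r'"
  then have "comb x y h (p - p') (q - q') (r - r') = 0"
    by (simp add: comb_def algebra_simps)
  from frame_independent[OF F L this] show "p = p' \<and> q = q' \<and> r = r'" by simp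
qed simp

end

section \<open>Periodic Lie algebra endomorphisms\<close>

context scalar_algebra
begin

definition linear_on :: "'s set \<Rightarrow> ('s \<Rightarrow> 's) \<Rightarrow> bool" where
  "linear_on L G \<longleftrightarrow> subspace L \<and> (\<forall>u\<in>L. G u \<in> L) \<and>
    (\<forall>u\<in>L. \<forall>v\<in>L. G (u + v) = G u + G v) \<and> (\<forall>k. \<forall>u\<in>L. G (k *s u) = k *s G u)"

lemma linear_on_funpow: "linear_on L G \<Longrightarrow> linear_on L (G ^^ n)"
  by (induction n) (simp_all add: linear_on_def)

end

context scalar_algebra_char_0
begin

lemma frame_mem: "sl2_frame c L x y h \<Longrightarrow> u \<in> L \<longleftrightarrow> (\<exists>p q r. u = comb x y h p q r)"
  unfolding sl2_frame_def by (auto simp: span3[symmetric])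

lemma frame_basis_mem: "sl2_frame c L x y h \<Longrightarrow> x \<in> L" "sl2_frame c L x y h \<Longrightarrow> y \<in> L" "sl2_frame c L x y h \<Longrightarrow> h \<in> L"
  by (auto simp: sl2_frame_def span_base)

lemma frame_subspace: "sl2_frame c L x y h \<Longrightarrow> subspace L"
  by (auto simp: sl2_frame_def)

definition bracket_endomorphism :: "'s set \<Rightarrow> ('s \<Rightarrow> 's) \<Rightarrow> bool" where
  "bracket_endomorphism L G \<longleftrightarrow> linear_on L G \<and> (\<forall>u\<in>L. \<forall>v\<in>L. G (u * v - v * u) = G u * G v - G v * G u)"

context
  fixes c :: 'k and L :: "'s set" and G :: "'s \<Rightarrow> 's" and l :: nat
  assumes L: "L \<noteq> {0}" and G: "bracket_endomorphism L G"
    and l: "l > 0" and periodic: "\<forall>u\<in>L. (G ^^ l) u = u"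
begin

lemma bracket_endo_closed: "u \<in> L \<Longrightarrow> G u \<in> L"
  and bracket_endo_add: "u \<in> L \<Longrightarrow> v \<in> L \<Longrightarrow> G (u + v) = G u + G v"
  and bracket_endo_scale: "u \<in> L \<Longrightarrow> G (k *s u) = k *s G u"
  and bracket_endo_bracket: "u \<in> L \<Longrightarrow> v \<in> L \<Longrightarrow> G (u * v - v * u) = G u * G v - G v * G u"
  using G by (auto simp: bracket_endomorphism_def linear_on_def)

lemma eigenvalue_nonzero:
  assumes "u \<in> L" "u \<noteq> 0" "G u = \<nu> *s u"
  shows "\<nu> \<noteq> 0"
proof
  assume "\<nu> = 0"
  then have "G u = 0" using assms by simp
  moreover have "G 0 = 0" using bracket_endo_scale[OF assms(1), of 0] by simp
  ultimately have "(G ^^ n) (G u) = 0" for n by (induction n) simp_all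
  from this[of "l - 1"] have "(G ^^ l) u = 0" using l by (cases l) (simp_all add: funpow_swap1)
  with bspec[OF periodic assms(1)] assms(2) show False by simp
qed

lemma bracket_endo_nonzero: "u \<in> L \<Longrightarrow> u \<noteq> 0 \<Longrightarrow> G u \<noteq> 0"
  using eigenvalue_nonzero[of u 0] by auto

lemma frame_nonzero:
  assumes "sl2_frame c L x y h"
  shows "x \<noteq> 0" "y \<noteq> 0" "h \<noteq> 0"
  using frame_independent[OF assms L, of 1 0 0] frame_independent[OF assms L, of 0 1 0]
    frame_independent[OF assms L, of 0 0 1] by (auto simp: comb_basis)

lemma bracket_h:
  assumes "sl2_frame c L x y h"
  shows "h * comb x y h p q r - comb x y h p q r * h = comb x y h p (- q) 0"
  using comb_bracket[of c x y h 0 0 1 p q r] assms by (simp add: sl2_frame_def comb_basis)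

text \<open>
  If \<open>h\<close> is fixed, \<open>G\<close> commutes with \<open>ad h\<close> and preserves its eigenlines; \<open>[x, y] = - 2 h\<close> makes the two
  eigenvalues inverse to each other.
\<close>

lemma diagonal_if_fixes_h:
  assumes F: "sl2_frame c L x y h" and h: "G h = h"
  shows "\<exists>\<nu> \<mu>. G x = \<nu> *s x \<and> G y = \<mu> *s y \<and> \<nu> * \<mu> = 1"
proof -
  note mem = frame_basis_mem[OF F]
  have T: "h * x - x * h = x" "h * y - y * h = (- 1) *s y" "y * x - x * y = h + h"
    using F by (simp_all add: sl2_frame_def sl2_triple_def algebra_simps)
  obtain p q r where x: "G x = comb x y h p q r" using frame_mem[OF F] bracket_endo_closed mem by blast
  have "comb x y h p (- q) 0 = comb x y h p q r"
    using bracket_endo_bracket[OF mem(3,1)] unfolding T h x bracket_h[OF F] by simp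
  then have "r = 0" "q = - q" by (simp_all add: frame_eq_iff[OF F L])
  then have Gx: "G x = p *s x" using x by (simp add: comb_def)
  obtain p' q' r' where y: "G y = comb x y h p' q' r'" using frame_mem[OF F] bracket_endo_closed mem by blast
  have "comb x y h p' (- q') 0 = (- 1) *s comb x y h p' q' r'"
    using bracket_endo_bracket[OF mem(3,2)] unfolding T h bracket_endo_scale[OF mem(2)] y bracket_h[OF F] by simp
  then have "r' = 0" "p' = - p'" by (simp_all add: frame_eq_iff[OF F L] comb_scale del: scale_minus_left)
  then have Gy: "G y = q' *s y" using y by (simp add: comb_def)
  have "h + h = G y * G x - G x * G y"
    using bracket_endo_bracket[OF mem(2,1)] unfolding T(3) bracket_endo_add[OF mem(3,3)] h .
  also have "\<dots> = (q' * p) *s (y * x - x * y)"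
    unfolding Gx Gy by (simp add: scale_right_diff_distrib mult.commute)
  finally have "1 *s h + 1 *s h = (q' * p) *s h + (q' * p) *s h"
    unfolding T(3) scale_right_distrib by simp
  then have "comb x y h 0 0 (1 + 1) = comb x y h 0 0 (q' * p + q' * p)"
    unfolding comb_def scale_left_distrib by simp
  then have "p * q' = 1" by (simp add: frame_eq_iff[OF F L] mult.commute)
  with Gx Gy show ?thesis by blast
qed

text \<open>
  Applying \<open>G\<close> to \<open>[h, x] = x\<close> shows that \<open>G h - h\<close> commutes with \<open>x\<close>, so \<open>G h = h + p x\<close>. Then \<open>h + s x\<close>
  is fixed if \<open>p + s \<nu> = s\<close>. This equation is solvable for \<open>\<nu> \<noteq> 1\<close>; for \<open>\<nu> = 1\<close> the \<open>n\<close>-th iterate of \<open>G\<close>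
  maps \<open>h\<close> to \<open>h + n p x\<close>, and periodicity in characteristic zero gives \<open>p = 0\<close>.
\<close>

lemma fixed_h_if_eigen_x:
  assumes F: "sl2_frame c L x y h" and x: "G x = \<nu> *s x"
  shows "\<exists>y' h'. sl2_frame c L x y' h' \<and> G h' = h'"
proof -
  note mem = frame_basis_mem[OF F]
  have \<nu>: "\<nu> \<noteq> 0" using eigenvalue_nonzero[OF mem(1) frame_nonzero(1)[OF F] x] .
  have hx: "h * x - x * h = x" using F by (simp add: sl2_frame_def sl2_triple_def)
  obtain p q r where h: "G h = comb x y h p q r" using frame_mem[OF F] bracket_endo_closed mem by blast
  have "\<nu> *s x = G h * (\<nu> *s x) - (\<nu> *s x) * G h"
    using bracket_endo_bracket[OF mem(3,1)] unfolding hx x .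
  then have "\<nu> *s x = \<nu> *s (G h * x - x * G h)" by (simp add: scale_right_diff_distrib)
  then have "comb x y h 1 0 0 = G h * comb x y h 1 0 0 - comb x y h 1 0 0 * G h"
    using \<nu> by (simp add: comb_basis)
  also have "\<dots> = comb x y h r 0 (q + q)"
    using comb_bracket[of c x y h p q r 1 0 0] F by (simp add: h sl2_frame_def)
  finally have "r = 1" "q + q = 0" by (simp_all add: frame_eq_iff[OF F L])
  then have Gh: "G h = h + p *s x" using h by (simp add: comb_def add.commute)
  have "\<exists>s. p + s * \<nu> = s"
  proof (cases "\<nu> = 1")
    case True
    have "(G ^^ n) h = h + (of_nat n * p) *s x" for n
    proof (induction n)
      case (Suc n)
      then show ?case
        using mem True Gh x by (simp add: bracket_endo_add bracket_endo_scale subspace_scale[OF frame_subspace[OF F]]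
            scale_left_distrib algebra_simps)
    qed simp
    from this[of l] bspec[OF periodic mem(3)] have "(of_nat l * p) *s x = 0" by simp
    then have "p = 0" using l frame_nonzero(1)[OF F] by simp
    then show ?thesis by (intro exI[of _ 0]) simp
  next
    case False
    then show ?thesis by (intro exI[of _ "p / (1 - \<nu>)"]) (simp add: field_simps)
  qed
  then obtain s where s: "p + s * \<nu> = s" by blast
  have "G (h + s *s x) = h + (p + s * \<nu>) *s x"
    using mem Gh x by (simp add: bracket_endo_add bracket_endo_scale subspace_scale[OF frame_subspace[OF F]] scale_left_distrib)
  with s frame_shear[OF F, of s] show ?thesis by auto
qed

end

end

locale scalar_algebra_closed = scalar_algebra_char_0 scale
  for scale :: "'k::{alg_closed_field, field_char_0} \<Rightarrow> 's::ring_1 \<Rightarrow> 's" (infixr "*s" 75)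
begin

text \<open>
  The vector \<open>p(G) u\<close>.
\<close>

definition orbit_poly :: "('s \<Rightarrow> 's) \<Rightarrow> 'k poly \<Rightarrow> 's \<Rightarrow> 's" where
  "orbit_poly G p u = (\<Sum>i\<le>Polynomial.degree p. Polynomial.coeff p i *s (G ^^ i) u)"

lemma orbit_poly_eq_sum:
  assumes "Polynomial.degree p \<le> n"
  shows "orbit_poly G p u = (\<Sum>i\<le>n. Polynomial.coeff p i *s (G ^^ i) u)"
  unfolding orbit_poly_def
  by (rule sum.mono_neutral_left) (use assms in \<open>auto simp: coeff_eq_0\<close>)

text \<open>
  That is, \<open>((G - \<zeta>) q(G)) u = q(G) (G u - \<zeta> u)\<close>.
\<close>

lemma orbit_poly_root_factor:
  assumes lin: "linear_on L G" and u: "u \<in> L"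
  shows "orbit_poly G ([:- \<zeta>, 1:] * q) u = orbit_poly G q (G u + (- \<zeta>) *s u)"
proof -
  let ?n = "Polynomial.degree q" and ?c = "Polynomial.coeff q"
  have Gu: "G u \<in> L" "(- \<zeta>) *s u \<in> L" using lin u subspace_scale[of L u "- \<zeta>"] by (auto simp: linear_on_def)
  have pow: "(G ^^ i) (v + w) = (G ^^ i) v + (G ^^ i) w" "(G ^^ i) (k *s v) = k *s (G ^^ i) v"
    if "v \<in> L" "w \<in> L" for i v w k
    using linear_on_funpow[OF lin, of i] that by (simp_all add: linear_on_def)
  have c: "Polynomial.coeff ([:- \<zeta>, 1:] * q) i
      = (case i of 0 \<Rightarrow> 0 | Suc j \<Rightarrow> ?c j) + (- \<zeta>) * ?c i" for i
    by (simp add: mult_pCons_left coeff_pCons)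
  have "Polynomial.degree ([:- \<zeta>, 1:] * q) \<le> Suc ?n"
    by (rule order_trans[OF degree_mult_le]) simp
  then have "orbit_poly G ([:- \<zeta>, 1:] * q) u
      = (\<Sum>i\<le>Suc ?n. (case i of 0 \<Rightarrow> 0 | Suc j \<Rightarrow> ?c j) *s (G ^^ i) u)
        + (\<Sum>i\<le>Suc ?n. ((- \<zeta>) * ?c i) *s (G ^^ i) u)"
    unfolding orbit_poly_eq_sum[OF \<open>_ \<le> Suc ?n\<close>] c
    by (simp only: scale_left_distrib sum.distrib)
  also have "(\<Sum>i\<le>Suc ?n. (case i of 0 \<Rightarrow> 0 | Suc j \<Rightarrow> ?c j) *s (G ^^ i) u)
      = (\<Sum>i\<le>?n. ?c i *s (G ^^ i) (G u))"
    by (simp add: sum.atMost_Suc_shift funpow_swap1 del: sum.atMost_Suc)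
  also have "(\<Sum>i\<le>Suc ?n. ((- \<zeta>) * ?c i) *s (G ^^ i) u) = (\<Sum>i\<le>?n. ?c i *s (G ^^ i) ((- \<zeta>) *s u))"
    by (simp only: sum.atMost_Suc pow(2)[OF u u]) (simp add: coeff_eq_0 mult.commute)
  also have "(\<Sum>i\<le>?n. ?c i *s (G ^^ i) (G u)) + (\<Sum>i\<le>?n. ?c i *s (G ^^ i) ((- \<zeta>) *s u))
      = orbit_poly G q (G u + (- \<zeta>) *s u)"
    unfolding orbit_poly_def pow(1)[OF Gu] by (simp only: scale_right_distrib sum.distrib)
  finally show ?thesis .
qed

text \<open>
  Linear factors are split off the polynomial one at a time: either \<open>u\<close> is already an eigenvector for the
  root, or \<open>G u - \<zeta> u\<close> is a nonzero vector annihilated by a polynomial of smaller degree.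
\<close>

lemma eigenvector_of_annihilating_poly:
  assumes lin: "linear_on L G"
    and "p \<noteq> 0" "u \<in> L" "u \<noteq> 0" "orbit_poly G p u = 0"
  shows "\<exists>v\<in>L. v \<noteq> 0 \<and> (\<exists>\<zeta>. G v = \<zeta> *s v)"
  using assms(2-5)
proof (induction "Polynomial.degree p" arbitrary: p u rule: less_induct)
  case less
  show ?case
  proof (cases "Polynomial.degree p = 0")
    case True
    then obtain k where "p = [:k:]" by (rule degree_eq_zeroE)
    with less.prems show ?thesis by (simp add: orbit_poly_def)
  next
    case False
    then obtain \<zeta> where "poly p \<zeta> = 0" using alg_closed_imp_poly_has_root by blast
    then obtain q where q: "p = [:- \<zeta>, 1:] * q" by (auto simp: poly_eq_0_iff_dvd elim: dvdE)
    define w where "w = G u + (- \<zeta>) *s u"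
    show ?thesis
    proof (cases "w = 0")
      case True
      then have "G u = \<zeta> *s u" by (simp add: w_def)
      with less.prems show ?thesis by blast
    next
      case False
      have "q \<noteq> 0" using q less.prems by auto
      then have "Polynomial.degree p = Suc (Polynomial.degree q)"
        unfolding q by (subst degree_mult_eq) auto
      then have "Polynomial.degree q < Polynomial.degree p" by simp
      moreover have "w \<in> L"
        unfolding w_def using less.prems lin by (intro subspace_add subspace_scale) (auto simp: linear_on_def)
      moreover have "orbit_poly G q w = 0"
        using less.prems(2,4) orbit_poly_root_factor[OF lin] by (simp add: q w_def)
      ultimately show ?thesis using less.hyps \<open>q \<noteq> 0\<close> False by blast
    qed
  qed
qed

lemma square_root_exists: "\<exists>k::'k. k * k = d"
proof -
  have "Polynomial.degree [:- d, 0, 1:] > 0" by simp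
  from alg_closed_imp_poly_has_root[OF this] show ?thesis by (auto simp: algebra_simps)
qed

context
  fixes c :: 'k and L :: "'s set" and G :: "'s \<Rightarrow> 's" and l :: nat
  assumes L: "L \<noteq> {0}" and G: "bracket_endomorphism L G"
    and l: "l > 0" and periodic: "\<forall>u\<in>L. (G ^^ l) u = u"
begin

lemma frame_scaled_h:
  assumes F: "sl2_frame c L x y h" and "r * r - 4 * p * q \<noteq> 0"
  shows "\<exists>k x' y'. k \<noteq> 0 \<and> sl2_frame c L x' y' (k *s comb x y h p q r)"
proof -
  obtain k where k: "k * k = r * r - 4 * p * q" using square_root_exists by blast
  with assms(2) have "k \<noteq> 0" by auto
  have "(1 / k * r) * (1 / k * r) - 4 * (1 / k * p) * (1 / k * q) = (1 / k) * (1 / k) * (r * r - 4 * p * q)"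
    by (simp add: algebra_simps)
  also have "\<dots> = 1" unfolding k[symmetric] using \<open>k \<noteq> 0\<close> by simp
  finally have "(1 / k * r) * (1 / k * r) - 4 * (1 / k * p) * (1 / k * q) = 1" .
  from frame_semisimple[OF F this] \<open>k \<noteq> 0\<close> show ?thesis
    unfolding comb_scale[symmetric] by (intro exI[of _ "1 / k"]) simp
qed

text \<open>
  Applying \<open>G\<close> to \<open>[h, x] = x\<close> shows that \<open>G x\<close> is an eigenvector of \<open>ad h\<close> with eigenvalue \<open>1 / \<nu>\<close>, so
  \<open>\<nu>\<close> is 1 or -1. For \<open>\<nu> = - 1\<close>, the map \<open>G\<close> exchanges the lines of \<open>x\<close> and \<open>y\<close>, and \<open>[x, y] = - 2 h\<close> implies
  \<open>G (G x) = x\<close>. The fixed element \<open>x + G x = x + q y\<close> has discriminant \<open>- 4 q \<noteq> 0\<close>, so a multiple of it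
  is the \<open>h\<close> of another basis.
\<close>

lemma fixed_h_if_eigen_h:
  assumes F: "sl2_frame c L x y h" and h: "G h = \<nu> *s h"
  shows "\<exists>x' y' h'. sl2_frame c L x' y' h' \<and> G h' = h'"
proof (cases "\<nu> = 1")
  case True
  with F h show ?thesis by auto
next
  case False
  note mem = frame_basis_mem[OF F]
  note G_rules = bracket_endo_closed[OF L G l periodic] bracket_endo_add[OF L G l periodic] bracket_endo_scale[OF L G l periodic]
    bracket_endo_bracket[OF L G l periodic]
  have T: "h * x - x * h = x" "h * y - y * h = (- 1) *s y" "y * x - x * y = h + h"
    using F by (simp_all add: sl2_frame_def sl2_triple_def algebra_simps)
  have scaled: "(\<nu> *s h) * v - v * (\<nu> *s h) = \<nu> *s (h * v - v * h)" for v
    by (simp add: scale_right_diff_distrib)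
  obtain p q r where x: "G x = comb x y h p q r" using frame_mem[OF F] G_rules(1) mem by blast
  have "\<nu> *s comb x y h p (- q) 0 = comb x y h p q r"
    using G_rules(4)[OF mem(3,1)] unfolding T h x scaled bracket_h[OF L G l periodic F] by simp
  then have 1: "r = 0" "\<nu> * p = p" "q = - (\<nu> * q)" by (simp_all add: frame_eq_iff[OF F L] comb_scale)
  with False have "p = 0" by simp
  have "G x \<noteq> 0" using bracket_endo_nonzero[OF L G l periodic mem(1)] frame_nonzero[OF L G l periodic F] by blast
  with x 1 \<open>p = 0\<close> have q: "q \<noteq> 0" by (auto simp: comb_def)
  have "(\<nu> + 1) * q = 0" using 1(3) by (simp add: distrib_right eq_neg_iff_add_eq_0 add.commute)
  with q have "\<nu> = - 1" by (simp add: eq_neg_iff_add_eq_0)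
  have Gx: "G x = q *s y" using x 1 \<open>p = 0\<close> by (simp add: comb_def)
  obtain p' q' r' where y: "G y = comb x y h p' q' r'" using frame_mem[OF F] G_rules(1) mem by blast
  have "\<nu> *s comb x y h p' (- q') 0 = (- 1) *s comb x y h p' q' r'"
    using G_rules(4)[OF mem(3,2)] unfolding T h G_rules(3)[OF mem(2)] y scaled bracket_h[OF L G l periodic F] by simp
  then have "r' = 0" "q' = - q'"
    by (simp_all add: frame_eq_iff[OF F L] comb_scale \<open>\<nu> = - 1\<close> del: scale_minus_left)
  then have Gy: "G y = p' *s x" using y by (simp add: comb_def)
  have "(- 1) *s h + (- 1) *s h = G y * G x - G x * G y"
    using G_rules(4)[OF mem(2,1)] unfolding T(3) G_rules(2)[OF mem(3,3)] h \<open>\<nu> = - 1\<close> .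
  also have "\<dots> = (p' * q) *s (x * y - y * x)"
    unfolding Gx Gy by (simp add: scale_right_diff_distrib mult.commute)
  also have "x * y - y * x = (- 1) *s h + (- 1) *s h"
    using T(3) by (simp add: algebra_simps)
  finally have "comb x y h 0 0 (- 1 + - 1) = comb x y h 0 0 (- (p' * q) + - (p' * q))"
    unfolding comb_def scale_left_distrib scale_right_distrib by simp
  then have "q * p' = 1" by (simp add: frame_eq_iff[OF F L] mult.commute)
  define u where "u = comb x y h 1 q 0"
  have "G u = u"
    using mem \<open>q * p' = 1\<close> unfolding u_def comb_def
    by (simp add: G_rules Gx Gy subspace_scale[OF frame_subspace[OF F]] add.commute)
  obtain k x' y' where "sl2_frame c L x' y' (k *s u)"
    using frame_scaled_h[OF F, of 0 1 q] q unfolding u_def by auto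
  moreover have "u \<in> L" using frame_mem[OF F] u_def by blast
  then have "G (k *s u) = k *s u" using G_rules(3) \<open>G u = u\<close> by simp
  ultimately show ?thesis by blast
qed

text \<open>
  An eigenvector of \<open>G\<close> exists because \<open>G\<close> is annihilated by \<open>X\<^sup>l - 1\<close>. Its discriminant decides
  which of the two constructions of a fixed semisimple element applies.
\<close>

theorem diagonalizing_frame_exists:
  assumes F: "sl2_frame c L x y h"
  shows "\<exists>x y h \<nu> \<mu>. sl2_frame c L x y h \<and> G h = h \<and> G x = \<nu> *s x \<and> G y = \<mu> *s y \<and> \<nu> * \<mu> = 1"
proof -
  note G_rules = bracket_endo_closed[OF L G l periodic] bracket_endo_add[OF L G l periodic] bracket_endo_scale[OF L G l periodic]
  have x: "x \<in> L" "x \<noteq> 0" using frame_basis_mem[OF F] frame_nonzero[OF L G l periodic F] by blast+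
  have "orbit_poly G (Polynomial.monom 1 l - 1) x = (\<Sum>i\<le>l. Polynomial.coeff (Polynomial.monom 1 l - 1) i *s (G ^^ i) x)"
    by (rule orbit_poly_eq_sum) (intro degree_diff_le degree_monom_le; simp)
  also have "\<dots> = (\<Sum>i\<in>{0, l}. Polynomial.coeff (Polynomial.monom 1 l - 1) i *s (G ^^ i) x)"
    by (rule sum.mono_neutral_right) (auto simp: coeff_1)
  also have "\<dots> = 0" using l bspec[OF periodic x(1)] by (simp add: coeff_1)
  finally have "orbit_poly G (Polynomial.monom 1 l - 1) x = 0" .
  moreover have "Polynomial.monom 1 l - (1 :: 'k poly) \<noteq> 0"
  proof
    assume "Polynomial.monom 1 l - (1 :: 'k poly) = 0"
    then have "Polynomial.coeff (Polynomial.monom 1 l - (1 :: 'k poly)) l = 0" by simp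
    then show False using l by (simp add: coeff_1)
  qed
  moreover have "linear_on L G" using G by (simp add: bracket_endomorphism_def)
  ultimately obtain u \<zeta> where u: "u \<in> L" "u \<noteq> 0" "G u = \<zeta> *s u"
    using eigenvector_of_annihilating_poly x by blast
  obtain p q r where pqr: "u = comb x y h p q r" using frame_mem[OF F] u(1) by blast
  have "\<exists>x y h. sl2_frame c L x y h \<and> G h = h"
  proof (cases "r * r = 4 * p * q")
    case True
    then obtain k x' y' h' where F': "sl2_frame c L x' y' h'" and k: "u = k *s x'"
      using frame_nilpotent[OF F] unfolding pqr by blast
    have "k \<noteq> 0" using k u(2) by auto
    have "k *s G x' = k *s (\<zeta> *s x')"
      using u(3) unfolding k G_rules(3)[OF frame_basis_mem(1)[OF F']] by (simp add: mult.commute)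
    with \<open>k \<noteq> 0\<close> have "G x' = \<zeta> *s x'" by (rule scale_left_imp_eq)
    from fixed_h_if_eigen_x[OF L G l periodic F' this] show ?thesis by blast
  next
    case False
    then have "r * r - 4 * p * q \<noteq> 0" by simp
    from frame_scaled_h[OF F this] obtain k x' y' where F': "sl2_frame c L x' y' (k *s u)"
      unfolding pqr by blast
    have "G (k *s u) = \<zeta> *s (k *s u)"
      using u by (simp add: G_rules mult.commute)
    from fixed_h_if_eigen_h[OF F' this] show ?thesis by blast
  qed
  then show ?thesis using diagonal_if_fixes_h[OF L G l periodic] by blast
qed

end

end

section \<open>Fixed elements of a diagonal automorphism\<close>

lemma ladder_mult_index: "ladder (x ^ m) (y ^ m) k = ladder x y (int m * k)"
proof (cases "m = 0")
  case False
  then have "int m * k \<ge> 0 \<longleftrightarrow> k \<ge> 0" by (simp add: zero_le_mult_iff)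
  moreover have "nat (int m * k) = m * nat k" "nat (- (int m * k)) = m * nat (- k)"
    by (simp_all add: nat_mult_distrib flip: mult_minus_right)
  ultimately show ?thesis by (simp add: ladder_def power_mult)
qed (simp add: ladder_def)

lemma ladder_eq_1_dvd:
  fixes \<nu> \<mu> :: "'a::comm_monoid_mult"
  assumes inverse: "\<nu> * \<mu> = 1" and "m > 0" and m: "\<nu> ^ m = 1"
    and least: "\<And>n. n > 0 \<Longrightarrow> \<nu> ^ n = 1 \<Longrightarrow> m \<le> n" and one: "ladder \<nu> \<mu> k = 1"
  shows "int m dvd k"
proof -
  define n where "n = nat \<bar>k\<bar>"
  have "\<nu> ^ n = 1"
  proof (cases "k \<ge> 0")
    case True
    with one show ?thesis by (simp add: ladder_def n_def)
  next
    case False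
    then have "\<mu> ^ n = 1" using one by (simp add: ladder_def n_def)
    moreover have "\<nu> ^ n * \<mu> ^ n = 1" by (simp add: inverse flip: power_mult_distrib)
    ultimately show ?thesis by simp
  qed
  moreover have "\<nu> ^ n = (\<nu> ^ m) ^ (n div m) * \<nu> ^ (n mod m)"
    by (simp flip: power_mult power_add)
  ultimately have "\<nu> ^ (n mod m) = 1" by (simp add: m)
  then have "n mod m = 0" using least[of "n mod m"] \<open>m > 0\<close> by (metis mod_less_divisor neq0_conv not_less)
  then have "m dvd n" by auto
  then show ?thesis by (simp add: n_def dvd_nat_abs_iff)
qed

context scalar_algebra_char_0
begin

definition algebra_endomorphism :: "'s set \<Rightarrow> ('s \<Rightarrow> 's) \<Rightarrow> bool" where
  "algebra_endomorphism B G \<longleftrightarrow> (\<forall>u\<in>B. G u \<in> B) \<and> (\<forall>u\<in>B. \<forall>v\<in>B. G (u + v) = G u + G v) \<and>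
    (\<forall>u\<in>B. \<forall>v\<in>B. G (u * v) = G u * G v) \<and> (\<forall>c. \<forall>u\<in>B. G (c *s u) = c *s G u) \<and> G 1 = 1"

context
  fixes \<alpha> a x y z G \<nu> \<mu>
  assumes F: "faithful_triple \<alpha> a x y z" and G: "algebra_endomorphism (generated x y z) G"
    and z: "G z = z" and x: "G x = \<nu> *s x" and y: "G y = \<mu> *s y" and inverse: "\<nu> * \<mu> = 1"
begin

lemma endomorphism_preserves:
  "u \<in> generated x y z \<Longrightarrow> v \<in> generated x y z \<Longrightarrow> G (u + v) = G u + G v"
  "u \<in> generated x y z \<Longrightarrow> v \<in> generated x y z \<Longrightarrow> G (u * v) = G u * G v"
  "u \<in> generated x y z \<Longrightarrow> G (c *s u) = c *s G u" "G 1 = 1"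
  using G by (auto simp: algebra_endomorphism_def)

lemma endomorphism_power: "u \<in> generated x y z \<Longrightarrow> G (u ^ n) = G u ^ n"
  by (induction n) (simp_all add: endomorphism_preserves subalgebra_power[OF subalgebra_generated])

lemma endomorphism_sum: "(\<And>k. k \<in> K \<Longrightarrow> f k \<in> generated x y z) \<Longrightarrow> G (sum f K) = (\<Sum>k\<in>K. G (f k))"
proof (induction K rule: infinite_finite_induct)
  case (insert k K)
  then show ?case
    by (simp add: endomorphism_preserves subalgebra_sum[OF subalgebra_generated])
qed (use endomorphism_preserves(3)[of 1 0] subalgebra_closed(1)[OF subalgebra_generated, of x y z] in simp_all)

lemma power_scale: "(c *s u) ^ n = (c ^ n) *s (u ^ n)"
  by (induction n) simp_all

lemma endomorphism_fixes_eval_at: "G (eval_at z p) = eval_at z p"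
  unfolding eval_at_def
  by (simp add: endomorphism_sum endomorphism_preserves endomorphism_power z generators_in_generated
      subalgebra_power[OF subalgebra_generated] subalgebra_closed(6)[OF subalgebra_generated])

lemma endomorphism_ladder: "G (ladder x y k) = ladder \<nu> \<mu> k *s ladder x y k"
  by (simp add: ladder_def endomorphism_power generators_in_generated x y power_scale)

text \<open>
  The endomorphism multiplies the \<open>k\<close>-th term of a normal form by \<open>\<nu>\<^sup>k\<close> and normal forms are unique,
  so only degrees divisible by the order \<open>m\<close> of \<open>\<nu>\<close> survive in a fixed element, and the rungs of these
  degrees are the rungs of \<open>x\<^sup>m\<close> and \<open>y\<^sup>m\<close>.
\<close>

theorem fixed_subalgebra_generated:
  assumes m: "m > 0" "\<nu> ^ m = 1" and least: "\<And>n. n > 0 \<Longrightarrow> \<nu> ^ n = 1 \<Longrightarrow> m \<le> n"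
  shows "{u \<in> generated x y z. G u = u} = generated (x ^ m) (y ^ m) z"
proof
  note gen = subalgebra_generated[of x y z]
  note gen' = subalgebra_generated[of "x ^ m" "y ^ m" z]
  have "\<nu> ^ m * \<mu> ^ m = 1" by (simp add: inverse flip: power_mult_distrib)
  then have \<mu>: "\<mu> ^ m = 1" using m(2) by simp
  show "generated (x ^ m) (y ^ m) z \<subseteq> {u \<in> generated x y z. G u = u}"
  proof (rule generated_subset)
    have "G (u - v) = G u - G v" if "u \<in> generated x y z" "v \<in> generated x y z" for u v
      using endomorphism_preserves(1)[of "u - v" v] that subalgebra_closed(4)[OF gen] by (simp add: eq_diff_eq)
    then show "subalgebra {u \<in> generated x y z. G u = u}"
      unfolding subalgebra_def
      by (simp add: endomorphism_preserves subalgebra_closed[OF gen])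
  qed (simp_all add: endomorphism_power generators_in_generated subalgebra_power[OF gen] x y z power_scale m \<mu>)
  show "{u \<in> generated x y z. G u = u} \<subseteq> generated (x ^ m) (y ^ m) z"
  proof clarify
    fix r assume fixed: "G (free_lift (gwa_subst x y z) r) = free_lift (gwa_subst x y z) r"
    have "gwa_family (shift \<alpha>) a (gwa_subst x y z)"
      using F by (simp add: faithful_triple_def gwa_family_triple)
    then obtain p K where K: "finite K" and "free_lift (gwa_subst x y z) r = (\<Sum>k\<in>K.
        gwa_subst x y z (Coef (p k)) * ladder (gwa_subst x y z LetterX) (gwa_subst x y z LetterY) k)"
      by (rule free_lift_range_normal_form)
    then have r: "free_lift (gwa_subst x y z) r = (\<Sum>k\<in>K. eval_at z (p k) * ladder x y k)" by simp
    let ?t = "\<lambda>k. eval_at z (p k) * ladder x y k"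
    have mem: "eval_at z q \<in> generated x y z" "ladder x y k \<in> generated x y z" for q k
      by (simp_all add: subalgebra_eval_at[OF gen] subalgebra_ladder[OF gen] generators_in_generated)
    have "G (\<Sum>k\<in>K. ?t k) = (\<Sum>k\<in>K. ladder \<nu> \<mu> k *s ?t k)"
      by (simp add: endomorphism_sum endomorphism_preserves endomorphism_fixes_eval_at endomorphism_ladder mem subalgebra_closed(5)[OF gen])
    then have "(\<Sum>k\<in>K. ladder \<nu> \<mu> k *s ?t k - ?t k) = 0"
      using fixed unfolding r by (simp add: sum_subtractf)
    moreover have "ladder \<nu> \<mu> k *s ?t k - ?t k
        = eval_at z (Polynomial.smult (ladder \<nu> \<mu> k - 1) (p k)) * ladder x y k" for k
      by (simp add: eval_at_smult scale_left_diff_distrib left_diff_distrib)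
    ultimately have "(\<Sum>k\<in>K. eval_at z (Polynomial.smult (ladder \<nu> \<mu> k - 1) (p k)) * ladder x y k) = 0"
      by simp
    from normal_form_components_eq_0[OF F K this]
    have zero: "ladder \<nu> \<mu> k = 1 \<or> p k = 0" if "k \<in> K" for k using that by simp
    have "?t k \<in> generated (x ^ m) (y ^ m) z" if "k \<in> K" for k
    proof (cases "p k = 0")
      case True
      then show ?thesis by (simp add: subalgebra_closed(2)[OF gen'])
    next
      case False
      with zero[OF that] have "int m dvd k"
        using ladder_eq_1_dvd[OF inverse m least] by blast
      then obtain j where "k = int m * j" ..
      then have "ladder x y k = ladder (x ^ m) (y ^ m) j" by (simp add: ladder_mult_index)
      then show ?thesis
        by (simp add: subalgebra_closed(5)[OF gen'] subalgebra_eval_at[OF gen'] subalgebra_ladder[OF gen']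
            generators_in_generated)
    qed
    then show "free_lift (gwa_subst x y z) r \<in> generated (x ^ m) (y ^ m) z"
      unfolding r by (rule subalgebra_sum[OF gen'])
  qed
qed

end

lemma faithful_triple_power:
  assumes "faithful_triple \<alpha> a x y z" "m > 0"
  shows "\<exists>b. faithful_triple (of_nat m * \<alpha>) b (x ^ m) (y ^ m) z"
  using gwa_triple_power[of \<alpha> a x y z m] assms by (auto simp: faithful_triple_def)

text \<open>
  The relations \<open>y x = h\<^sup>2 + h + c\<close> and \<open>x y = h\<^sup>2 - h + c\<close> agree with \<open>\<sigma> h = h - 1\<close>, since substituting
  \<open>h - 1\<close> for \<open>h\<close> turns the first polynomial into the second.
\<close>

lemma faithful_triple_of_sl2:
  assumes T: "sl2_triple c x y h" and "transcendental h"
  shows "faithful_triple 1 [:c, 1, 1:] x y h"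
proof -
  have rel: "h * x = x * h + x" "h * y = y * h - y" "y * x = h * h + h + c *s 1" "x * y = h * h - h + c *s 1"
    using T by (simp_all add: sl2_triple_def)
  have "shift 1 [:c, 1, 1:] = [:c, - 1, 1:]"
    by (simp add: shift_def pcompose_pCons)
  then show ?thesis
    unfolding faithful_triple_def gwa_triple_def
    using assms(2) by (simp add: rel eval_at_pCons left_diff_distrib algebra_simps)
qed

lemma generated_eqI:
  assumes "x' \<in> generated x y z" "y' \<in> generated x y z" "z' \<in> generated x y z"
    and "x \<in> generated x' y' z'" "y \<in> generated x' y' z'" "z \<in> generated x' y' z'"
  shows "generated x' y' z' = generated x y z"
  using assms generated_subset[OF subalgebra_generated] by (intro equalityI) blast+

lemma comb_in_subalgebra:
  "subalgebra S \<Longrightarrow> x \<in> S \<Longrightarrow> y \<in> S \<Longrightarrow> h \<in> S \<Longrightarrow> comb x y h p q r \<in> S"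
  by (simp add: comb_def subalgebra_closed)

lemma generated_frame:
  assumes F: "sl2_frame c L x y h" and F': "sl2_frame c L x' y' h'"
  shows "generated x' y' h' = generated x y h"
proof -
  have "u \<in> generated x y h" if frm: "sl2_frame c L x y h" and u: "u \<in> L" for u x y h
  proof -
    obtain p q r where "u = comb x y h p q r" using frame_mem[OF frm] u by blast
    then show ?thesis
      using comb_in_subalgebra[OF subalgebra_generated generators_in_generated] by simp
  qed
  then show ?thesis using frame_basis_mem[OF F] frame_basis_mem[OF F'] F F'
    by (intro generated_eqI) blast+
qed

lemma commutator_in_frame_span:
  assumes F: "sl2_frame c L x y h" and "u = k *s 1 + u'" "v = k' *s 1 + v'" "u' \<in> L" "v' \<in> L"
  shows "u * v - v * u \<in> L"
proof -
  have "u * v - v * u = u' * v' - v' * u'"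
    unfolding assms(2,3) by (simp add: distrib_left distrib_right algebra_simps)
  moreover obtain p q r p' q' r' where "u' = comb x y h p q r" "v' = comb x y h p' q' r'"
    using frame_mem[OF F] assms(4,5) by blast
  moreover have "sl2_triple c x y h" using F by (simp add: sl2_frame_def)
  ultimately show ?thesis using frame_mem[OF F] comb_bracket by metis
qed

text \<open>
  Each of \<open>x, y, h\<close> is a scalar multiple of a commutator of two of them, and commutators of elements of
  \<open>\<bbbk> + L\<close> lie in \<open>L\<close>. Therefore preserving \<open>\<bbbk> + L\<close> is enough to preserve \<open>L\<close>.
\<close>

lemma bracket_endomorphism_of_filtered:
  assumes F: "sl2_frame c L x y h" and B: "L \<subseteq> B" "subalgebra B" and G: "algebra_endomorphism B G"
    and filtered: "\<And>u. u \<in> {x, y, h} \<Longrightarrow> \<exists>k. \<exists>v\<in>L. G u = k *s 1 + v"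
  shows "bracket_endomorphism L G"
proof -
  have T: "x = h * x - x * h" "y = y * h - h * y" "h = (1/2) *s (y * x - x * y)"
  proof -
    have "y * x - x * y = 1 *s h + 1 *s h" using F by (simp add: sl2_frame_def sl2_triple_def)
    also have "\<dots> = 2 *s h" by (simp only: one_add_one[symmetric] scale_left_distrib)
    finally show "h = (1/2) *s (y * x - x * y)" by simp
  qed (use F in \<open>simp_all add: sl2_frame_def sl2_triple_def\<close>)
  note mem = frame_basis_mem[OF F]
  have memB: "x \<in> B" "y \<in> B" "h \<in> B" using mem B(1) by auto
  have G_rules: "G (u + v) = G u + G v" "G (u * v) = G u * G v" "G (c *s u) = c *s G u" if "u \<in> B" "v \<in> B" for u v c
    using G that by (auto simp: algebra_endomorphism_def)
  have G_comm: "G (u * v - v * u) = G u * G v - G v * G u" if "u \<in> B" "v \<in> B" for u v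
  proof -
    have prods: "u * v \<in> B" "v * u \<in> B" using that B(2) by (auto simp: subalgebra_closed)
    then have "(- 1) *s (v * u) \<in> B" using B(2) by (simp add: subalgebra_closed(6) del: scale_minus_left)
    then have "G (u * v + (- 1) *s (v * u)) = G u * G v + (- 1) *s (G v * G u)"
      using prods that by (simp add: G_rules del: scale_minus_left)
    then show ?thesis by simp
  qed
  have comm: "G u * G v - G v * G u \<in> L" if "u \<in> {x, y, h}" "v \<in> {x, y, h}" for u v
    using filtered[OF that(1)] filtered[OF that(2)] commutator_in_frame_span[OF F] by blast
  have Gx: "G x \<in> L" using comm[of h x] G_comm[OF memB(3,1)] T(1) by simp
  have Gy: "G y \<in> L" using comm[of y h] G_comm[OF memB(2,3)] T(2) by simp
  have "y * x - x * y \<in> B" using memB B(2) by (simp add: subalgebra_closed)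
  then have "G h = (1/2) *s (G y * G x - G x * G y)"
    using T(3) G_rules(3) G_comm[OF memB(2,1)] by metis
  then have Gh: "G h \<in> L"
    using comm[of y x] subspace_scale[OF frame_subspace[OF F]] by simp
  have G_comb: "G (comb x y h p q r) = comb (G x) (G y) (G h) p q r" for p q r
    unfolding comb_def using memB B(2) by (simp add: G_rules subalgebra_closed)
  have "G u \<in> L" if u: "u \<in> L" for u
  proof -
    obtain p q r where "u = comb x y h p q r" using frame_mem[OF F] u by blast
    then show ?thesis
      using Gx Gy Gh frame_subspace[OF F] by (simp only: G_comb) (simp add: comb_def subspace_add subspace_scale)
  qed
  then show ?thesis
    unfolding bracket_endomorphism_def linear_on_def
  proof (intro conjI ballI allI)
    fix u v k assume uv: "u \<in> L" "v \<in> L"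
    then have "u \<in> B" "v \<in> B" using B(1) by auto
    then show "G (u + v) = G u + G v" "G (u * v - v * u) = G u * G v - G v * G u"
      by (rule G_rules G_comm)+
  next
    fix u k assume "u \<in> L"
    then have "u \<in> B" using B(1) by auto
    from G_rules(3)[OF this this] show "G (k *s u) = k *s G u" .
  qed (rule frame_subspace[OF F])
qed

end

section \<open>A faithful representation by operators on functions\<close>

text \<open>
  The algebra acts on functions of one variable \<open>w\<close>: \<open>x\<close> as the shift \<open>w \<mapsto> w - 1\<close>, \<open>y\<close> as the opposite
  shift followed by multiplication by \<open>a\<close>, and \<open>z\<close> as multiplication by \<open>w\<close>. In characteristic zero
  polynomials are determined by their values, so \<open>z\<close> is transcendental and the representation is
  faithful.
\<close>

typedef (overloaded) 'k fun_op =
  "{T :: ('k::field \<Rightarrow> 'k) \<Rightarrow> ('k \<Rightarrow> 'k).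
     (\<forall>f g. T (\<lambda>w. f w + g w) = (\<lambda>w. T f w + T g w)) \<and> (\<forall>c f. T (\<lambda>w. c * f w) = (\<lambda>w. c * T f w))}"
  morphisms apply_op Fun_Op
  by (rule exI[of _ "\<lambda>f. f"]) simp

setup_lifting type_definition_fun_op

lemma fun_op_eqI: "(\<And>f w. apply_op S f w = apply_op T f w) \<Longrightarrow> S = T"
  by (simp add: apply_op_inject[symmetric] fun_eq_iff)

lemma apply_op_linear:
  "apply_op T (\<lambda>w. f w + g w) = (\<lambda>w. apply_op T f w + apply_op T g w)"
  "apply_op T (\<lambda>w. c * f w) = (\<lambda>w. c * apply_op T f w)"
  using apply_op[of T] by auto

instantiation fun_op :: (field) ring_1
begin

lift_definition zero_fun_op :: "'a fun_op" is "\<lambda>_ _. 0" by simp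
lift_definition one_fun_op :: "'a fun_op" is "\<lambda>f. f" by simp
lift_definition plus_fun_op :: "'a fun_op \<Rightarrow> 'a fun_op \<Rightarrow> 'a fun_op" is "\<lambda>S T f w. S f w + T f w"
  by (simp add: algebra_simps)
lift_definition minus_fun_op :: "'a fun_op \<Rightarrow> 'a fun_op \<Rightarrow> 'a fun_op" is "\<lambda>S T f w. S f w - T f w"
  by (simp add: algebra_simps)
lift_definition uminus_fun_op :: "'a fun_op \<Rightarrow> 'a fun_op" is "\<lambda>T f w. - T f w"
  by (simp add: algebra_simps)
lift_definition times_fun_op :: "'a fun_op \<Rightarrow> 'a fun_op \<Rightarrow> 'a fun_op" is "\<lambda>S T f. S (T f)"
  by simp

lemmas apply_ring_op = zero_fun_op.rep_eq one_fun_op.rep_eq plus_fun_op.rep_eq minus_fun_op.rep_eq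
  uminus_fun_op.rep_eq times_fun_op.rep_eq

instance
proof
  show "(0 :: 'a fun_op) \<noteq> 1"
  proof
    assume "(0 :: 'a fun_op) = 1"
    then have "apply_op (0 :: 'a fun_op) (\<lambda>_. 1) 0 = apply_op 1 (\<lambda>_. 1) 0" by simp
    then show False by (simp add: apply_ring_op)
  qed
qed (rule fun_op_eqI; simp add: apply_ring_op apply_op_linear algebra_simps)+

end

lift_definition scale_op :: "'k::field \<Rightarrow> 'k fun_op \<Rightarrow> 'k fun_op" is "\<lambda>c T f w. c * T f w"
  by (simp add: algebra_simps)

lift_definition x_op :: "'k::field fun_op" is "\<lambda>f w. f (w - 1)" by simp
lift_definition y_op :: "'k::field poly \<Rightarrow> 'k fun_op" is "\<lambda>a f w. poly a w * f (w + 1)"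
  by (simp add: algebra_simps)
lift_definition z_op :: "'k::field fun_op" is "\<lambda>f w. w * f w" by (simp add: algebra_simps)

interpretation op: scalar_algebra_closed
  "scale_op :: 'k::{alg_closed_field, field_char_0} \<Rightarrow> 'k fun_op \<Rightarrow> 'k fun_op"
proof
  fix c d :: 'k and S T :: "'k fun_op"
  show "scale_op c (S + T) = scale_op c S + scale_op c T" "scale_op (c + d) S = scale_op c S + scale_op d S"
    "scale_op c (scale_op d S) = scale_op (c * d) S" "scale_op 1 S = S"
    "scale_op c S * T = scale_op c (S * T)" "S * scale_op c T = scale_op c (S * T)"
    by (rule fun_op_eqI; simp add: apply_ring_op scale_op.rep_eq apply_op_linear algebra_simps)+
qed

lemmas apply_op_simps = apply_ring_op scale_op.rep_eq x_op.rep_eq y_op.rep_eq z_op.rep_eq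

lemma apply_eval_at_multiplication:
  fixes u :: "'k::{alg_closed_field, field_char_0} fun_op"
  assumes "\<And>f w. apply_op u f w = m w * f w"
  shows "apply_op (op.eval_at u p) f w = poly p (m w) * f w"
  by (induction p) (simp_all add: op.eval_at_pCons apply_op_simps assms algebra_simps)

lemma gwa_triple_op:
  "op.gwa_triple 1 a x_op (y_op a) (z_op :: 'k::{alg_closed_field, field_char_0} fun_op)"
proof -
  have z: "apply_op (op.eval_at z_op p) f w = poly p w * f w" for p f and w :: 'k
    by (rule apply_eval_at_multiplication) (simp add: apply_op_simps)
  show ?thesis
    unfolding op.gwa_triple_def
    by (intro conjI fun_op_eqI) (simp_all add: apply_op_simps z shift_def poly_pcompose algebra_simps)
qed

lemma transcendental_multiplication:
  fixes u :: "'k::{alg_closed_field, field_char_0} fun_op"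
  assumes u: "\<And>f w. apply_op u f w = (r * w + s) * f w" and "r \<noteq> 0"
  shows "op.transcendental u"
  unfolding op.transcendental_def
proof (intro allI impI)
  fix p assume "op.eval_at u p = 0"
  then have zero: "poly p (r * w + s) = 0" for w
    using apply_eval_at_multiplication[OF u, of p "\<lambda>_. 1" w] by (simp add: apply_op_simps)
  have "poly p v = 0" for v
    using zero[of "(v - s) / r"] \<open>r \<noteq> 0\<close> by simp
  then show "p = 0" by (simp add: poly_all_0_iff_0[symmetric])
qed

text \<open>
  Starting from the indicator function of the point \<open>b\<close>, each application of \<open>u\<close> moves the front of the
  support by exactly one step in direction \<open>e\<close>. Hence \<open>u\<^sup>n\<close> is the first power that reaches the point
  \<open>b + n e\<close>, and at this point the leading term of a polynomial in \<open>u\<close> cannot be cancelled.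
\<close>

lemma transcendental_propagation:
  fixes u :: "'k::{alg_closed_field, field_char_0} fun_op"
  assumes u: "\<And>f w. apply_op u f w = A w * f (w - e) + C w * f (w + e) + D w * f w" and "e \<noteq> 0"
    and A: "\<And>n. A (b + of_nat (Suc n) * e) \<noteq> 0"
  shows "op.transcendental u"
  unfolding op.transcendental_def
proof (intro allI impI)
  define \<delta> where "\<delta> = (\<lambda>w. if w = b then 1 else (0::'k))"
  define F where "F n = apply_op (u ^ n) \<delta>" for n
  have F_Suc: "F (Suc n) w = A w * F n (w - e) + C w * F n (w + e) + D w * F n w" for n w
    by (simp add: F_def apply_op_simps u)
  have front: "(\<forall>m>n. F n (b + of_nat m * e) = 0) \<and> F n (b + of_nat n * e) \<noteq> 0" for n
  proof (induction n)
    case 0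
    then show ?case using \<open>e \<noteq> 0\<close> by (simp add: F_def \<delta>_def apply_op_simps)
  next
    case (Suc n)
    have step: "F (Suc n) (b + of_nat (Suc m) * e) =
      A (b + of_nat (Suc m) * e) * F n (b + of_nat m * e)" if "m \<ge> n" for m
    proof -
      have "b + of_nat (Suc m) * e - e = b + of_nat m * e"
        and "b + of_nat (Suc m) * e + e = b + of_nat (Suc (Suc m)) * e" by (simp_all add: algebra_simps)
      moreover have "F n (b + of_nat (Suc (Suc m)) * e) = 0" "F n (b + of_nat (Suc m) * e) = 0"
        using Suc.IH that by (simp_all del: of_nat_Suc)
      ultimately show ?thesis by (simp only: F_Suc mult_zero_right add_0_right)
    qed
    have "F (Suc n) (b + of_nat m * e) = 0" if "m > Suc n" for m
    proof (cases m)
      case (Suc m')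
      then show ?thesis using step[of m'] Suc.IH that by (simp del: of_nat_Suc)
    qed (use that in simp)
    moreover have "F (Suc n) (b + of_nat (Suc n) * e) \<noteq> 0"
      using step[of n] Suc.IH A[of n] by simp
    ultimately show ?case by blast
  qed
  fix p assume zero: "op.eval_at u p = 0"
  define n where "n = Polynomial.degree p"
  have apply_sum: "apply_op (sum f K) \<delta> w = (\<Sum>i\<in>K. apply_op (f i) \<delta> w)" for f :: "nat \<Rightarrow> 'k fun_op" and K w
    by (induction K rule: infinite_finite_induct) (simp_all add: apply_op_simps)
  have "0 = (\<Sum>i\<le>n. Polynomial.coeff p i * F i (b + of_nat n * e))"
    using arg_cong[OF zero, of "\<lambda>T. apply_op T \<delta> (b + of_nat n * e)"]
    by (simp add: op.eval_at_def apply_sum apply_op_simps F_def n_def)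
  also have "\<dots> = (\<Sum>i\<in>{n}. Polynomial.coeff p i * F i (b + of_nat n * e))"
    by (rule sum.mono_neutral_right) (use front in auto)
  finally show "p = 0"
    using front[of n] by (simp add: n_def)
qed

text \<open>
  A nonzero \<open>x\<close>-component moves the support upwards and a nonzero \<open>y\<close>-component moves it downwards;
  without either, the operator is multiplication by a polynomial of degree 1.
\<close>

lemma transcendental_comb:
  fixes a :: "'k::{alg_closed_field, field_char_0} poly"
  assumes "a \<noteq> 0" and nz: "op.comb x_op (y_op a) (z_op - scale_op s 1) p q r \<noteq> 0"
  shows "op.transcendental (op.comb x_op (y_op a) (z_op - scale_op s 1) p q r)"
proof -
  let ?u = "op.comb x_op (y_op a) (z_op - scale_op s 1) p q r"
  have u: "apply_op ?u f w = p * f (w - 1) + q * poly a w * f (w + 1) + (r * w + - r * s) * f w" for f w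
    by (simp add: op.comb_def apply_op_simps algebra_simps)
  consider "p \<noteq> 0" | "q \<noteq> 0" | "p = 0" "q = 0" by blast
  then show ?thesis
  proof cases
    case 1
    then show ?thesis by (intro transcendental_propagation[OF u]) simp_all
  next
    case 2
    \<comment> \<open>The downward front is stopped by zeros of \<open>a\<close>. There are finitely many of them, so the
      starting point \<open>- N\<close> is chosen below all those at nonpositive integers.\<close>
    have "finite {n. poly a (- of_nat n) = 0}"
      using finite_vimageI[OF poly_roots_finite[OF \<open>a \<noteq> 0\<close>], of "\<lambda>n. - of_nat n"]
      by (simp add: inj_on_def vimage_def)
    then obtain N where N: "\<And>n. poly a (- of_nat n) = 0 \<Longrightarrow> n < N"
      by (auto simp: finite_nat_set_iff_bounded)
    show ?thesis
    proof (rule transcendental_propagation)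
      show "apply_op ?u f w = q * poly a w * f (w - - 1) + p * f (w + - 1) + (r * w + - r * s) * f w" for f w
        by (simp add: u)
      show "q * poly a (- of_nat N + of_nat (Suc n) * - 1) \<noteq> 0" for n
        using N[of "N + Suc n"] 2 by (auto simp: algebra_simps)
    qed simp
  next
    case 3
    then have "r \<noteq> 0" using nz by (auto simp: op.comb_def)
    have "apply_op ?u f w = (r * w + - r * s) * f w" for f w
      unfolding u using 3 by simp
    from transcendental_multiplication[OF this \<open>r \<noteq> 0\<close>] show ?thesis .
  qed
qed

lemma transcendental_z_op: "op.transcendental (z_op :: 'k::{alg_closed_field, field_char_0} fun_op)"
  by (rule transcendental_multiplication[of _ 1 0]) (simp_all add: apply_op_simps)

section \<open>The standard filtration in low degrees\<close>

lemma std_filtration_mono: "std_filtration \<alpha> a m r \<Longrightarrow> m \<le> m' \<Longrightarrow> std_filtration \<alpha> a m' r"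
proof (induction arbitrary: m' rule: std_filtration.induct)
  case (mult i r j s m)
  from std_filtration.mult[OF mult.hyps(1,2)] mult.hyps(3) mult.prems show ?case by simp
next
  case (scalar m c)
  show ?case by (rule std_filtration.scalar)
qed (meson std_filtration.x std_filtration.y std_filtration.z std_filtration.add order_trans)+

text \<open>
  Exhaustiveness guarantees that the least degree in the definition of \<open>std_degree\<close> is attained.
\<close>

lemma std_filtration_exhaustive: "\<exists>m. std_filtration \<alpha> a m (gwa_class (shift \<alpha>) a r)"
proof (induction r rule: free_ring_induct)
  have fil_add: "\<exists>m. std_filtration \<alpha> a m (gwa_class (shift \<alpha>) a (u + v))"
    if fil: "\<exists>m. std_filtration \<alpha> a m (gwa_class (shift \<alpha>) a u)"
      "\<exists>m. std_filtration \<alpha> a m (gwa_class (shift \<alpha>) a v)" for u v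
  proof -
    obtain m n where "std_filtration \<alpha> a m (gwa_class (shift \<alpha>) a u)"
      "std_filtration \<alpha> a n (gwa_class (shift \<alpha>) a v)" using fil by blast
    then have "std_filtration \<alpha> a (max m n) (gwa_class (shift \<alpha>) a u)"
      "std_filtration \<alpha> a (max m n) (gwa_class (shift \<alpha>) a v)"
      by (auto elim: std_filtration_mono)
    from std_filtration.add[OF this] show ?thesis by (auto simp: gwa_class_hom)
  qed
  have fil_mult: "\<exists>m. std_filtration \<alpha> a m (gwa_class (shift \<alpha>) a (u * v))"
    if "\<exists>m. std_filtration \<alpha> a m (gwa_class (shift \<alpha>) a u)"
      "\<exists>m. std_filtration \<alpha> a m (gwa_class (shift \<alpha>) a v)" for u v
    using that std_filtration.mult[OF _ _ order_refl, of \<alpha> a] by (fastforce simp: gwa_class_hom)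
  have const: "\<exists>m. std_filtration \<alpha> a m (gwa_class (shift \<alpha>) a (letter (Coef [:c:])))" for c
    using std_filtration.scalar[of \<alpha> a 0 c] by (auto simp: gwa_class_hom cgwa_coef_def)
  have coef: "\<exists>m. std_filtration \<alpha> a m (gwa_class (shift \<alpha>) a (letter (Coef p)))" for p
  proof (induction p)
    case 0
    show ?case using const[of 0] by simp
  next
    case (pCons c p)
    have "gwa_class (shift \<alpha>) a (letter (Coef (pCons c p)))
        = gwa_class (shift \<alpha>) a (letter (Coef [:c:]) + letter (Coef ([:0, 1:] * p)))"
      using gwa_class_relations(1)[of "shift \<alpha>" a "[:c:]" "[:0, 1:] * p"] by simp
    also have "\<dots> = gwa_class (shift \<alpha>) a (letter (Coef [:c:]) + letter (Coef [:0, 1:]) * letter (Coef p))"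
      by (intro gwa_class_cong refl gwa_class_relations)
    finally show ?case
      using fil_add[OF const fil_mult[OF _ pCons.IH], of "letter (Coef [:0, 1:])" c] std_filtration.z[of 2 \<alpha> a]
      unfolding cgwa_z_def cgwa_coef_def by auto
  qed
  {
    case one
    show ?case using const[of 1] gwa_class_relations(3)[of "shift \<alpha>" a] by (simp add: one_pCons)
  next
    case (letter u)
    show ?case
    proof (cases u)
      case LetterX
      then show ?thesis using std_filtration.x[of a _ \<alpha>] by (auto simp: cgwa_x_def)
    next
      case LetterY
      then show ?thesis using std_filtration.y[of a _ \<alpha>] by (auto simp: cgwa_y_def)
    qed (simp add: coef)
  next
    case (diff r s)
    have "gwa_class (shift \<alpha>) a (r + letter (Coef (- 1)) * s) = gwa_class (shift \<alpha>) a (r + - 1 * s)"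
      by (intro gwa_class_cong refl coef_uminus_1)
    with fil_add[OF diff(1) fil_mult[OF coef diff(2)], of "- 1"] show ?case by simp
  next
    case (mult r s)
    then show ?case by (rule fil_mult)
  }
qed

lemma std_filtration_std_degree:
  assumes "r \<in> carrier (cgwa \<alpha> a)"
  shows "std_filtration \<alpha> a (std_degree \<alpha> a r) r"
  using assms std_filtration_exhaustive[of \<alpha> a] unfolding std_degree_def by (auto intro: LeastI_ex)

lemma filtered_aut_preserves_filtration:
  assumes g: "g \<in> filtered_aut \<alpha> a" and r: "r \<in> carrier (cgwa \<alpha> a)" "std_filtration \<alpha> a m r"
  shows "std_filtration \<alpha> a m (g r)"
proof -
  have "g r \<in> carrier (cgwa \<alpha> a)"
    using g r(1) by (auto simp: filtered_aut_def alg_aut_def alg_iso_def ring_iso_def ring_hom_def simp del: cgwa_ops)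
  then have "std_filtration \<alpha> a (std_degree \<alpha> a (g r)) (g r)" by (rule std_filtration_std_degree)
  moreover have "std_degree \<alpha> a (g r) = std_degree \<alpha> a r"
    using g r(1) by (simp add: filtered_aut_def del: cgwa_ops)
  moreover have "std_degree \<alpha> a r \<le> m"
    unfolding std_degree_def using r(2) by (rule Least_le)
  ultimately show ?thesis using std_filtration_mono by metis
qed

context scalar_algebra_char_0
begin

text \<open>
  The bounds in degrees below 2 and below 4 are proved together: in a product of total degree below 4
  one factor has degree below 2 and is a scalar.
\<close>

lemma std_filtration_low_degree:
  assumes F: "faithful_triple \<alpha> a x y z" and deg: "Polynomial.degree a = 2" and V: "subspace V"
    "1 \<in> V" "x \<in> V" "y \<in> V" "z \<in> V" and r: "std_filtration \<alpha> a m r"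
  shows "r \<in> carrier (cgwa \<alpha> a) \<and> (m < 2 \<longrightarrow> (\<exists>k. realize \<alpha> a x y z r = k *s 1)) \<and>
    (m < 4 \<longrightarrow> realize \<alpha> a x y z r \<in> V)"
  using r
proof (induction rule: std_filtration.induct)
  case (scalar m c)
  show ?case
    using realize_scale[OF F cgwa_generators_in_carrier(1)[OF F], of c] realize_simps[OF F] V
    by (auto simp: subspace_scale simp del: cgwa_ops)
next
  case (x m)
  then show ?case
    using cgwa_generators_in_carrier[OF F] realize_simps[OF F] V deg by (auto simp del: cgwa_ops)
next
  case (y m)
  then show ?case
    using cgwa_generators_in_carrier[OF F] realize_simps[OF F] V deg by (auto simp del: cgwa_ops)
next
  case (z m)
  then show ?case
    using cgwa_generators_in_carrier[OF F] realize_simps[OF F] V by (auto simp del: cgwa_ops)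
next
  case (add m r s)
  then have "r \<in> carrier (cgwa \<alpha> a)" "s \<in> carrier (cgwa \<alpha> a)" by blast+
  note rules = realize_hom(2,4)[OF F this]
  show ?case
  proof (intro conjI impI)
    assume "m < 2"
    then obtain k k' where "realize \<alpha> a x y z r = k *s 1" "realize \<alpha> a x y z s = k' *s 1"
      using add.IH by blast
    then show "\<exists>k. realize \<alpha> a x y z (r \<oplus>\<^bsub>cgwa \<alpha> a\<^esub> s) = k *s 1"
      unfolding rules by (metis scale_left_distrib)
  next
    assume "m < 4"
    then show "realize \<alpha> a x y z (r \<oplus>\<^bsub>cgwa \<alpha> a\<^esub> s) \<in> V"
      unfolding rules using add.IH V(1) by (intro subspace_add) blast+
  qed (rule realize_hom[OF F \<open>r \<in> _\<close> \<open>s \<in> _\<close>])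
next
  case (mult i r j s m)
  then have "r \<in> carrier (cgwa \<alpha> a)" "s \<in> carrier (cgwa \<alpha> a)" by blast+
  note rules = realize_hom(1,3)[OF F this]
  show ?case
  proof (intro conjI impI)
    assume "m < 2"
    then obtain k k' where "realize \<alpha> a x y z r = k *s 1" "realize \<alpha> a x y z s = k' *s 1"
      using mult.IH mult.hyps by (metis add_leD1 add_leD2 le_less_trans)
    then show "\<exists>k. realize \<alpha> a x y z (r \<otimes>\<^bsub>cgwa \<alpha> a\<^esub> s) = k *s 1"
      unfolding rules by auto
  next
    assume "m < 4"
    then have "i < 4" "j < 4" "i < 2 \<or> j < 2" using mult.hyps(3) by linarith+
    then have mem: "realize \<alpha> a x y z r \<in> V" "realize \<alpha> a x y z s \<in> V"
      and "(\<exists>k. realize \<alpha> a x y z r = k *s 1) \<or> (\<exists>k. realize \<alpha> a x y z s = k *s 1)"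
      using mult.IH by blast+
    then show "realize \<alpha> a x y z (r \<otimes>\<^bsub>cgwa \<alpha> a\<^esub> s) \<in> V"
      unfolding rules using V(1) by (auto simp: subspace_scale)
  qed (rule realize_hom[OF F \<open>r \<in> _\<close> \<open>s \<in> _\<close>])
qed

text \<open>
  The map \<open>g\<close>, transported to the ring that contains the realization.
\<close>

definition conjugate :: "'k \<Rightarrow> 'k poly \<Rightarrow> 's \<Rightarrow> 's \<Rightarrow> 's \<Rightarrow> ('k poly gwa_elt \<Rightarrow> 'k poly gwa_elt) \<Rightarrow> 's \<Rightarrow> 's" where
  "conjugate \<alpha> a x y z g u =
    realize \<alpha> a x y z (g (inv_into (carrier (cgwa \<alpha> a)) (realize \<alpha> a x y z) u))"

context
  fixes \<alpha> a x y z g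
  assumes F: "faithful_triple \<alpha> a x y z" and g: "g \<in> alg_iso (cgwa \<alpha> a) (cgwa \<alpha> a)"
begin

lemma alg_iso_preserves:
  assumes "r \<in> carrier (cgwa \<alpha> a)"
  shows "g r \<in> carrier (cgwa \<alpha> a)"
    and "s \<in> carrier (cgwa \<alpha> a) \<Longrightarrow> g (r \<oplus>\<^bsub>cgwa \<alpha> a\<^esub> s) = g r \<oplus>\<^bsub>cgwa \<alpha> a\<^esub> g s"
    and "s \<in> carrier (cgwa \<alpha> a) \<Longrightarrow> g (r \<otimes>\<^bsub>cgwa \<alpha> a\<^esub> s) = g r \<otimes>\<^bsub>cgwa \<alpha> a\<^esub> g s"
    and "g (c \<odot>\<^bsub>cgwa \<alpha> a\<^esub> r) = c \<odot>\<^bsub>cgwa \<alpha> a\<^esub> g r"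
    and "g \<one>\<^bsub>cgwa \<alpha> a\<^esub> = \<one>\<^bsub>cgwa \<alpha> a\<^esub>"
  using g assms by (auto simp: alg_iso_def ring_iso_def ring_hom_def simp del: cgwa_ops)

lemma conjugate_realize:
  "r \<in> carrier (cgwa \<alpha> a) \<Longrightarrow> conjugate \<alpha> a x y z g (realize \<alpha> a x y z r) = realize \<alpha> a x y z (g r)"
  using realize_bij[OF F] by (simp add: conjugate_def bij_betw_def inv_into_f_f del: cgwa_ops)

lemma conjugate_funpow_realize:
  "r \<in> carrier (cgwa \<alpha> a) \<Longrightarrow>
    (conjugate \<alpha> a x y z g ^^ n) (realize \<alpha> a x y z r) = realize \<alpha> a x y z ((g ^^ n) r)
    \<and> (g ^^ n) r \<in> carrier (cgwa \<alpha> a)"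
  by (induction n) (simp_all add: conjugate_realize alg_iso_preserves del: cgwa_ops)

lemma generated_realize:
  assumes "u \<in> generated x y z"
  obtains r where "r \<in> carrier (cgwa \<alpha> a)" "u = realize \<alpha> a x y z r"
  using assms realize_bij[OF F] by (auto simp: bij_betw_def simp del: cgwa_ops)

lemma algebra_endomorphism_conjugate:
  "algebra_endomorphism (generated x y z) (conjugate \<alpha> a x y z g)"
proof -
  let ?G = "conjugate \<alpha> a x y z g" and ?i = "realize \<alpha> a x y z"
  have "?G u \<in> generated x y z \<and> ?G (c *s u) = c *s ?G u"
    and "?G (u + v) = ?G u + ?G v \<and> ?G (u * v) = ?G u * ?G v"
    if u: "u \<in> generated x y z" and v: "v \<in> generated x y z" for u v c
  proof -
    obtain r where r: "r \<in> carrier (cgwa \<alpha> a)" "u = ?i r" using u by (rule generated_realize)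
    obtain s where s: "s \<in> carrier (cgwa \<alpha> a)" "v = ?i s" using v by (rule generated_realize)
    show "?G u \<in> generated x y z \<and> ?G (c *s u) = c *s ?G u"
      unfolding r(2) using r(1) bij_betw_apply[OF realize_bij[OF F] alg_iso_preserves(1)[OF r(1)]]
      by (simp add: conjugate_realize alg_iso_preserves realize_scale(2)[OF F] flip: realize_scale(1)[OF F] del: cgwa_ops)
    note carrier = alg_iso_preserves(1)[OF r(1)] alg_iso_preserves(1)[OF s(1)]
    show "?G (u + v) = ?G u + ?G v \<and> ?G (u * v) = ?G u * ?G v"
      unfolding r(2) s(2) realize_hom(1,2)[OF F r(1) s(1), symmetric]
        conjugate_realize[OF realize_hom(3)[OF F r(1) s(1)]] conjugate_realize[OF realize_hom(4)[OF F r(1) s(1)]]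
        conjugate_realize[OF r(1)] conjugate_realize[OF s(1)] alg_iso_preserves(2,3)[OF r(1) s(1)]
        realize_hom(1,2)[OF F carrier]
      by simp
  qed
  moreover have "?G 1 = 1"
    using conjugate_realize[OF cgwa_generators_in_carrier(1)[OF F]] alg_iso_preserves(5)[OF cgwa_generators_in_carrier(1)[OF F]]
    by (simp add: realize_simps[OF F] del: cgwa_ops)
  ultimately show ?thesis unfolding algebra_endomorphism_def by blast
qed

end

end

section \<open>Diagonalization of filtered automorphisms\<close>

lemma BijGroup_funpow:
  assumes "g \<in> Bij S"
  shows "g [^]\<^bsub>BijGroup S\<^esub> n = restrict (g ^^ n) S \<and> g [^]\<^bsub>BijGroup S\<^esub> n \<in> Bij S"
proof (induction n)
  case 0
  show ?case using id_Bij by (simp add: BijGroup_def restrict_def)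
next
  case (Suc n)
  then have IH: "g [^]\<^bsub>BijGroup S\<^esub> n = restrict (g ^^ n) S" "g [^]\<^bsub>BijGroup S\<^esub> n \<in> Bij S" by blast+
  have mult: "u \<otimes>\<^bsub>BijGroup S\<^esub> v = compose S u v" if "u \<in> Bij S" "v \<in> Bij S" for u v
    using that by (simp add: BijGroup_def)
  have "g [^]\<^bsub>BijGroup S\<^esub> Suc n = g [^]\<^bsub>BijGroup S\<^esub> n \<otimes>\<^bsub>BijGroup S\<^esub> g"
    by (rule monoid.nat_pow_Suc[OF group.is_monoid[OF group_BijGroup]])
  also have "\<dots> = compose S (g [^]\<^bsub>BijGroup S\<^esub> n) g"
    by (rule mult[OF IH(2) assms])
  finally have step: "g [^]\<^bsub>BijGroup S\<^esub> Suc n = compose S (g [^]\<^bsub>BijGroup S\<^esub> n) g" .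
  have "compose S (restrict (g ^^ n) S) g = restrict (g ^^ Suc n) S"
    using Bij_imp_funcset[OF assms] by (auto simp: compose_def restrict_def fun_eq_iff funpow_swap1)
  then show ?case
    unfolding step using compose_Bij[OF IH(2) assms] by (simp only: IH(1) simp_thms)
qed

lemma funpow_ord_BijGroup:
  assumes "g \<in> Bij S" "r \<in> S"
  shows "(g ^^ group.ord (BijGroup S) g) r = r"
proof -
  have "g [^]\<^bsub>BijGroup S\<^esub> group.ord (BijGroup S) g = \<one>\<^bsub>BijGroup S\<^esub>"
    using assms(1) by (intro group.pow_ord_eq_1[OF group_BijGroup]) (simp add: BijGroup_def)
  then have "restrict (g ^^ group.ord (BijGroup S) g) S = restrict (\<lambda>r. r) S"
    using BijGroup_funpow[OF assms(1)] by (simp add: BijGroup_def)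
  from fun_cong[OF this, of r] assms(2) show ?thesis by simp
qed

context scalar_algebra_char_0
begin

lemma scaled_generator:
  assumes F: "faithful_triple \<alpha> a x y z" and g: "g \<in> alg_iso (cgwa \<alpha> a) (cgwa \<alpha> a)"
    and r: "r \<in> carrier (cgwa \<alpha> a)"
    and "conjugate \<alpha> a x y z g (realize \<alpha> a x y z r) = c *s realize \<alpha> a x y z r"
  shows "g r = c \<odot>\<^bsub>cgwa \<alpha> a\<^esub> r"
proof (rule inj_onD[of "realize \<alpha> a x y z"])
  show "inj_on (realize \<alpha> a x y z) (carrier (cgwa \<alpha> a))"
    using realize_bij[OF F] by (simp add: bij_betw_def)
  show "realize \<alpha> a x y z (g r) = realize \<alpha> a x y z (c \<odot>\<^bsub>cgwa \<alpha> a\<^esub> r)"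
    using assms(4) conjugate_realize[OF F g r] realize_scale[OF F r] by simp
qed (rule alg_iso_preserves(1)[OF F g r] realize_scale(2)[OF F r])+

text \<open>
  A diagonal generating triple is a diagonalizing presentation. For the fixed ring, the scalar \<open>\<nu>\<close> is
  a root of unity because \<open>g\<close> has finite order; its multiplicative order \<open>m\<close> is the exponent that appears
  in the generators \<open>x'\<^sup>m\<close> and \<open>y'\<^sup>m\<close>.
\<close>

theorem diagonalizable_and_fixed_ring:
  assumes F: "faithful_triple \<alpha> a x y z" and g: "g \<in> alg_iso (cgwa \<alpha> a) (cgwa \<alpha> a)"
    and l: "l > 0" "\<And>r. r \<in> carrier (cgwa \<alpha> a) \<Longrightarrow> (g ^^ l) r = r"
    and F': "faithful_triple \<beta> b x' y' z'" and gen: "generated x' y' z' = generated x y z"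
    and diag: "conjugate \<alpha> a x y z g x' = \<nu> *s x'" "conjugate \<alpha> a x y z g y' = \<mu> *s y'"
      "conjugate \<alpha> a x y z g z' = z'" and inverse: "\<nu> * \<mu> = 1"
  shows "diagonalizable_action (cgwa \<alpha> a) g \<and> is_classical_gwa (fixed_ring (cgwa \<alpha> a) g)"
proof
  let ?R = "cgwa \<alpha> a" and ?i = "realize \<alpha> a x y z" and ?G = "conjugate \<alpha> a x y z g"
  have surj: "?i ` carrier ?R = generated x y z"
    using realize_bij[OF F] by (simp add: bij_betw_def)
  obtain \<phi> where \<phi>: "\<phi> \<in> alg_iso (cgwa \<beta> b) ?R"
    and i\<phi>: "\<And>u. u \<in> carrier (cgwa \<beta> b) \<Longrightarrow> ?i (\<phi> u) = realize \<beta> b x' y' z' u"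
    using cgwa_iso_of_generated[OF F F' order_refl] surj gen by (auto simp del: cgwa_ops)
  have mem: "\<phi> u \<in> carrier ?R" if "u \<in> carrier (cgwa \<beta> b)" for u
    using \<phi> that by (auto simp: alg_iso_def ring_iso_def ring_hom_def simp del: cgwa_ops)
  note gens = cgwa_generators_in_carrier[OF F']
  note i_gens = i\<phi>[OF gens(2)] i\<phi>[OF gens(3)] i\<phi>[OF gens(4)]
  have "g (\<phi> (cgwa_x \<beta> b)) = \<nu> \<odot>\<^bsub>?R\<^esub> \<phi> (cgwa_x \<beta> b)" "g (\<phi> (cgwa_y \<beta> b)) = \<mu> \<odot>\<^bsub>?R\<^esub> \<phi> (cgwa_y \<beta> b)"
    "g (\<phi> (cgwa_z \<beta> b)) = 1 \<odot>\<^bsub>?R\<^esub> \<phi> (cgwa_z \<beta> b)"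
    using gens by (intro scaled_generator[OF F g mem]; simp add: i_gens realize_simps[OF F'] diag del: cgwa_ops)+
  moreover have "\<beta> \<noteq> 0" using F' by (simp add: faithful_triple_def)
  ultimately show "diagonalizable_action ?R g"
    unfolding diagonalizable_action_def classical_gwa_presentation_def using \<phi> by blast

  have G: "algebra_endomorphism (generated x' y' z') ?G"
    using algebra_endomorphism_conjugate[OF F g] gen by simp
  have power: "(?G ^^ n) x' = \<nu> ^ n *s x'" for n
  proof (induction n)
    case (Suc n)
    have "?G (\<nu> ^ n *s x') = \<nu> ^ n *s ?G x'"
      using G generators_in_generated(1) unfolding algebra_endomorphism_def by blast
    with Suc show ?case by (simp add: diag mult.commute)
  qed simp
  have "x' \<noteq> 0"
    using eval_at_mult_ladder_eq_0[OF F', of 1 1] by (auto simp: ladder_def)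
  obtain r where r: "r \<in> carrier ?R" "x' = ?i r"
    using generators_in_generated(1)[of x' y' z'] unfolding gen by (rule generated_realize[OF F g])
  have "(?G ^^ l) x' = x'"
    using conjugate_funpow_realize[OF F g r(1), of l] l(2)[OF r(1)] r(2) by simp
  then have "\<nu> ^ l *s x' = 1 *s x'" by (simp add: power)
  then have "\<nu> ^ l = 1" using \<open>x' \<noteq> 0\<close> by (rule scale_right_imp_eq[rotated])
  define m where "m = (LEAST n. n > 0 \<and> \<nu> ^ n = 1)"
  have m: "m > 0" "\<nu> ^ m = 1"
    using LeastI[of "\<lambda>n. n > 0 \<and> \<nu> ^ n = 1" l] l(1) \<open>\<nu> ^ l = 1\<close> by (simp_all add: m_def)
  have least: "m \<le> n" if "n > 0" "\<nu> ^ n = 1" for n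
    unfolding m_def using that by (intro Least_le) simp
  obtain b' where F'': "faithful_triple (of_nat m * \<beta>) b' (x' ^ m) (y' ^ m) z'"
    using faithful_triple_power[OF F' m(1)] by blast
  let ?K = "{r \<in> carrier ?R. g r = r}"
  have "?i ` ?K = {u \<in> generated x' y' z'. ?G u = u}"
  proof (intro equalityI subsetI)
    fix u assume "u \<in> ?i ` ?K"
    then show "u \<in> {u \<in> generated x' y' z'. ?G u = u}"
      using surj by (auto simp: gen conjugate_realize[OF F g] simp del: cgwa_ops)
  next
    fix u assume u: "u \<in> {u \<in> generated x' y' z'. ?G u = u}"
    then have "u \<in> generated x y z" by (simp add: gen)
    then obtain r where r: "r \<in> carrier ?R" "u = ?i r" by (rule generated_realize[OF F g])
    have "?i (g r) = ?i r" using u r by (simp add: conjugate_realize[OF F g] del: cgwa_ops)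
    then have "g r = r"
      using realize_bij[OF F] alg_iso_preserves(1)[OF F g r(1)] r(1) by (auto simp: bij_betw_def inj_on_def simp del: cgwa_ops)
    with r show "u \<in> ?i ` ?K" by blast
  qed
  also have "\<dots> = generated (x' ^ m) (y' ^ m) z'"
    by (rule fixed_subalgebra_generated[OF F' G diag(3,1,2) inverse m least])
  finally obtain \<psi> where "\<psi> \<in> alg_iso (cgwa (of_nat m * \<beta>) b') (?R\<lparr>carrier := ?K\<rparr>)"
    using cgwa_iso_of_generated[OF F F'', of ?K] by (auto simp del: cgwa_ops)
  moreover have "of_nat m * \<beta> \<noteq> 0" using F'' by (simp add: faithful_triple_def)
  ultimately show "is_classical_gwa (fixed_ring ?R g)"
    unfolding is_classical_gwa_def fixed_ring_def by blast
qed

end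

theorem theorem2p10:
  fixes t :: "'k::{alg_closed_field, field_char_0}"
    and a :: "'k poly"
    and R :: "('k, 'k poly gwa_elt) module"
    and g :: "'k poly gwa_elt \<Rightarrow> 'k poly gwa_elt"
    and l :: nat
  assumes "a = [:0, 1:] * [:- t, 1:]"
    and "R = cgwa 1 a"
    and "g \<in> filtered_aut 1 a"
    and "group.ord (BijGroup (carrier R)) g = l"
    and "2 \<le> l"
  shows "diagonalizable_action R g \<and> is_classical_gwa (fixed_ring R g)"
proof -
  \<comment> \<open>Substituting \<open>z = h + s\<close> in \<open>z (z - t)\<close> gives \<open>h\<^sup>2 + h + c\<close>: the shift by \<open>s\<close> is the one for which
    \<open>[x, y]\<close> is a multiple of \<open>h\<close>.\<close>
  define s where "s = (1 + t) / 2"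
  define c where "c = s * (s - t)"
  define x :: "'k fun_op" where "x = x_op"
  define y where "y = y_op a"
  define z :: "'k fun_op" where "z = z_op"
  define h where "h = z - scale_op s 1"
  define L where "L = op.span {x, y, h}"
  let ?i = "op.realize 1 a x y z" and ?G = "op.conjugate 1 a x y z g"
  have a: "a = [:0, - t, 1:]" using assms(1) by simp
  then have deg: "Polynomial.degree a = 2" "a \<noteq> 0" by simp_all
  have F: "op.faithful_triple 1 a x y z"
    unfolding op.faithful_triple_def x_def y_def z_def
    by (simp add: deg gwa_triple_op transcendental_z_op)
  have t: "t = 2 * s - 1" by (simp add: s_def field_simps)
  have "op.sl2_triple c x y h"
    unfolding op.sl2_triple_def x_def y_def h_def z_def
    by (intro conjI fun_op_eqI) (simp_all add: apply_op_simps a c_def t algebra_simps)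
  then have frm: "op.sl2_frame c L x y h" by (simp add: op.sl2_frame_def L_def)
  have "x \<noteq> 0"
  proof
    assume "x = 0"
    then have "apply_op x (\<lambda>_. 1) 0 = 0" by (simp add: apply_op_simps)
    then show False by (simp add: x_def apply_op_simps)
  qed
  then have L: "L \<noteq> {0}" using op.frame_basis_mem(1)[OF frm] by auto
  have hz: "op.generated x y h = op.generated x y z"
  proof (rule op.generated_eqI)
    have "z = h + scale_op s 1" by (simp add: h_def)
    then show "z \<in> op.generated x y h"
      by (simp add: op.subalgebra_closed[OF op.subalgebra_generated] op.generators_in_generated)
    show "h \<in> op.generated x y z"
      by (simp add: h_def op.subalgebra_closed[OF op.subalgebra_generated] op.generators_in_generated)
  qed (rule op.generators_in_generated)+
  have g: "g \<in> alg_iso (cgwa 1 a) (cgwa 1 a)" and "g \<in> Bij (carrier R)"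
    using assms(2,3) by (auto simp: filtered_aut_def alg_aut_def alg_iso_def ring_iso_def Bij_def simp del: cgwa_ops)
  then have periodic: "(g ^^ l) r = r" if "r \<in> carrier (cgwa 1 a)" for r
    using funpow_ord_BijGroup[of g "carrier R" r] that assms(2,4) by simp

  \<comment> \<open>The space \<open>V\<close> contains the image of the elements of degree at most 2, hence the images of \<open>x, y, z\<close> under \<open>g\<close>.\<close>
  define V where "V = {u. \<exists>k. \<exists>v\<in>L. u = scale_op k 1 + v}"
  have LV: "L \<subseteq> V"
    unfolding V_def by (auto intro!: exI[of _ 0])
  have V: "op.subspace V" "1 \<in> V" "x \<in> V" "y \<in> V" "z \<in> V"
  proof -
    have subL: "op.subspace L" by (rule op.frame_subspace[OF frm])
    show "op.subspace V"
      unfolding op.subspace_def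
    proof (intro conjI ballI allI)
      show "0 \<in> V" using LV op.subspace_0[OF subL] by blast
      fix u v k assume "u \<in> V" "v \<in> V"
      then obtain k1 v1 k2 v2 where "u = scale_op k1 1 + v1" "v1 \<in> L" "v = scale_op k2 1 + v2" "v2 \<in> L"
        unfolding V_def by blast
      then show "u + v \<in> V"
        unfolding V_def using op.subspace_add[OF subL]
        by (auto simp: op.scale_left_distrib algebra_simps intro!: exI[of _ "k1 + k2"] bexI[of _ "v1 + v2"])
    next
      fix u k assume "u \<in> V"
      then obtain k1 v1 where "u = scale_op k1 1 + v1" "v1 \<in> L" unfolding V_def by blast
      then show "scale_op k u \<in> V"
        unfolding V_def using op.subspace_scale[OF subL]
        by (auto simp: op.scale_right_distrib intro!: exI[of _ "k * k1"] bexI[of _ "scale_op k v1"])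
    qed
    show "1 \<in> V" unfolding V_def using op.subspace_0[OF subL] by (auto intro!: exI[of _ 1] bexI[of _ 0])
    show "x \<in> V" "y \<in> V" using op.frame_basis_mem[OF frm] LV by blast+
    show "z \<in> V" unfolding V_def using op.frame_basis_mem(3)[OF frm]
      by (auto simp: h_def intro!: exI[of _ s] bexI[of _ h])
  qed
  have G_gens: "?G x \<in> V" "?G y \<in> V" "?G z \<in> V"
  proof -
    note gens = op.cgwa_generators_in_carrier[OF F]
    have "?i (g r) \<in> V" if "r \<in> carrier (cgwa 1 a)" "std_filtration 1 a 2 r" for r
      using op.std_filtration_low_degree[OF F deg(1) V filtered_aut_preserves_filtration[OF assms(3) that]] by simp
    then have "?G (?i r) \<in> V" if "r \<in> carrier (cgwa 1 a)" "std_filtration 1 a 2 r" for r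
      using that by (simp add: op.conjugate_realize[OF F g] del: cgwa_ops)
    from this[OF gens(2)] this[OF gens(3)] this[OF gens(4)] show "?G x \<in> V" "?G y \<in> V" "?G z \<in> V"
      by (simp_all add: op.realize_simps[OF F] std_filtration.x std_filtration.y std_filtration.z deg)
  qed
  have endo: "op.algebra_endomorphism (op.generated x y h) ?G"
    using op.algebra_endomorphism_conjugate[OF F g] hz by simp
  have "?G h = ?G z + scale_op (- s) 1"
  proof -
    let ?B = "op.generated x y z"
    have endo: "op.algebra_endomorphism ?B ?G" by (rule op.algebra_endomorphism_conjugate[OF F g])
    have one: "1 \<in> ?B" by (rule op.subalgebra_closed[OF op.subalgebra_generated])
    then have "scale_op (- s) 1 \<in> ?B" by (rule op.subalgebra_closed[OF op.subalgebra_generated])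
    with endo op.generators_in_generated(3) have "?G (z + scale_op (- s) 1) = ?G z + ?G (scale_op (- s) 1)"
      unfolding op.algebra_endomorphism_def by blast
    moreover have "?G (scale_op (- s) 1) = scale_op (- s) (?G 1)" "?G 1 = 1"
      using endo one unfolding op.algebra_endomorphism_def by blast+
    moreover have "h = z + scale_op (- s) 1" by (simp add: h_def)
    ultimately show ?thesis by simp
  qed
  then have "?G h \<in> V"
    using op.subspace_add[OF V(1) G_gens(3) op.subspace_scale[OF V(1,2), of "- s"]] by simp
  with G_gens have filtered: "\<exists>k. \<exists>v\<in>L. ?G u = scale_op k 1 + v" if "u \<in> {x, y, h}" for u
    using that unfolding V_def by blast
  have LB: "L \<subseteq> op.generated x y h"
    unfolding L_def using op.generators_in_generated
    by (intro op.span_minimal) (auto simp: op.subspace_def op.subalgebra_closed[OF op.subalgebra_generated])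
  have bracket: "op.bracket_endomorphism L ?G"
    by (rule op.bracket_endomorphism_of_filtered[OF frm LB op.subalgebra_generated endo filtered])
  have "(?G ^^ l) u = u" if "u \<in> L" for u
  proof -
    have "u \<in> op.generated x y z" using that LB hz by blast
    then obtain r where "r \<in> carrier (cgwa 1 a)" "u = ?i r" by (rule op.generated_realize[OF F g])
    then show ?thesis using op.conjugate_funpow_realize[OF F g] periodic by (simp del: cgwa_ops)
  qed
  then have periodic_G: "\<forall>u\<in>L. (?G ^^ l) u = u" by blast
  have l: "l > 0" using assms(5) by simp
  obtain x' y' h' \<nu> \<mu> where frm': "op.sl2_frame c L x' y' h'" and diag: "?G h' = h'"
    "?G x' = scale_op \<nu> x'" "?G y' = scale_op \<mu> y'" "\<nu> * \<mu> = 1"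
    using op.diagonalizing_frame_exists[OF L bracket l periodic_G frm] by blast
  \<comment> \<open>In coordinates of the original basis, \<open>h'\<close> is an operator whose transcendence is already known.\<close>
  obtain p q r where h': "h' = op.comb x y h p q r"
    using op.frame_mem[OF frm] op.frame_basis_mem(3)[OF frm'] by blast
  have "h' \<noteq> 0" by (rule op.frame_nonzero(3)[OF L bracket l periodic_G frm'])
  then have "op.transcendental h'"
    using transcendental_comb[OF deg(2)] unfolding h' x_def y_def h_def z_def by blast
  then have F': "op.faithful_triple 1 [:c, 1, 1:] x' y' h'"
    using frm' by (intro op.faithful_triple_of_sl2) (simp_all add: op.sl2_frame_def)
  have "op.generated x' y' h' = op.generated x y z"
    using op.generated_frame[OF frm frm'] hz by simp
  from op.diagonalizable_and_fixed_ring[OF F g l periodic F' this diag(2,3,1,4)]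
  show ?thesis by (simp add: assms(2))
qed

end
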